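(* Let $m\ge 2$ and let $A_1,\dots,A_m$ be real symmetric $n\times n$ matrices such that there is no $\lambda\in\mathbb{R}^m$ with $\lambda_1A_1+\cdots+\lambda_mA_m\succ0$, but there is a nonzero $\lambda\in\mathbb{R}^m$ with $\lambda_1A_1+\cdots+\lambda_mA_m\succeq 0$; fix such a $\lambda$, assumed (without loss of generality) to satisfy $\lambda_m\neq0$, and put $\tilde A_m:=\lambda_1A_1+\cdots+\lambda_mA_m$. Let $\mathcal{A}_i^3$, and (when $\mathcal{A}_1^3,\dots,\mathcal{A}_m^3$ are SD) $\mathbf{A}_i^1,\mathbf{A}_i^2,\mathbf{A}_i^3,\mathbf{A}_i^4$, $\mathbf{D}_2$, $\mathbf{D}_3$ be the blocks defined in the context. Then the following three assertions are equivalent: (a) $A_1,A_2,\dots,A_m$ are SD. (b) $A_1,A_2,\dots,A_{m-1}$ and $\tilde A_m$ are SD. (c) $\mathcal{A}_i^3$, $i=1,2,\dots,m$, are SD, and the following conditions are also satisfied: 1. $\mathbf{A}_i^4=0$ for $i=1,2,\dots,m-1$; 2. $\mathbf{A}_i^2=\mathbf{D}_2\mathbf{D}_3^{-1}\mathbf{A}_i^3$ for $i=1,2,\dots,m-1$; 3. the matrices $\mathbf{A}_i^1-\mathbf{A}_i^2\mathbf{D}_3^{-1}\mathbf{D}_2^T$, $i=1,2,\dots,m-1$, mutually commute.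
   Context: Real symmetric matrices $M_1,\dots,M_k$ of the same size are called simultaneously diagonalizable via congruence (SD) if there is a nonsingular real matrix $P$ such that every $P^TM_iP$ is diagonal. $\operatorname{diag}(X_1,\dots,X_k)$ denotes the block diagonal matrix with square blocks $X_1,\dots,X_k$; $M\succ0$ ($M\succeq0$) means positive definite (semidefinite). For a diagonal matrix $D$, $\operatorname{supp}(D)=\{i: D_{ii}\ne0\}$. Definition of the blocks. Let $Q_1$ be a nonsingular real matrix with $$\mathcal{A}_m:=Q_1^T\tilde A_mQ_1=\begin{pmatrix}I_p&0\\0&0\end{pmatrix},\qquad p<n,$$ and write, for $i=1,\dots,m-1$, $$\mathcal{A}_i:=Q_1^TA_iQ_1=\begin{pmatrix}\mathcal{A}_i^1&\mathcal{A}_i^2\\(\mathcal{A}_i^2)^T&\mathcal{A}_i^3\end{pmatrix},$$ where $\mathcal{A}_i^1$ is $p\times p$. $\mathcal{A}_m^3$ is the corresponding lower right $(n-p)\times(n-p)$ block of $\mathcal{A}_m$ (the zero matrix). If $\mathcal{A}_1^3,\dots,\mathcal{A}_m^3$ are SD, choose a nonsingular $V$ that makes all $V^T\mathcal{A}_i^3V$ diagonal, with the diagonal positions at which all of these matrices vanish arranged last, and let $Q_2:=\operatorname{diag}(I_p,V)$. Then $Q_2^T\mathcal{A}_mQ_2=\operatorname{diag}(I_p,0)$ and for $i=1,\dots,m-1$ $$\mathbf{A}_i:=Q_2^T\mathcal{A}_iQ_2=\begin{pmatrix}\mathbf{A}_i^1&\mathbf{A}_i^2&\mathbf{A}_i^4\\(\mathbf{A}_i^2)^T&\mathbf{A}_i^3&0\\(\mathbf{A}_i^4)^T&0&0\end{pmatrix},$$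 where $\mathbf{A}_i^1=\mathcal{A}_i^1$ and $\mathbf{A}_1^3,\dots,\mathbf{A}_{m-1}^3$ are $q\times q$ diagonal matrices having no common zero diagonal position (for each position $j\le q$ some $\mathbf{A}_i^3$ has nonzero $(j,j)$ entry). Real numbers $\mu_1,\dots,\mu_{m-1}$ such that $\mathbf{D}_3:=\sum_{i=1}^{m-1}\mu_i\mathbf{A}_i^3$ is nonsingular are chosen by the following procedure: start with $\mu_1=1$, all other $\mu_i=0$, and $D=\mathbf{A}_1^3$; for $j=1,2,\dots,m-2$ in turn, choose $\mu_{j+1}=s/q$ with $s\in\{0,1,\dots,q\}$ such that $\operatorname{supp}(D+\mu_{j+1}\mathbf{A}_{j+1}^3)=\operatorname{supp}(D)\cup\operatorname{supp}(\mathbf{A}_{j+1}^3)$, replace $D$ by $D+\mu_{j+1}\mathbf{A}_{j+1}^3$, and stop as soon as the new $D$ is nonsingular (the remaining $\mu_i$ stay $0$). (If $m=2$ this just means $\mu_1=1$; if $q=0$, blocks of size $0$ are empty, any $\mu$ may be used, and terms containing $\mathbf{D}_3^{-1}$ are zero.) Finally $\mathbf{D}_2:=\sum_{i=1}^{m-1}\mu_i\mathbf{A}_i^2$. *)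

theory Defs
  imports
    "Jordan_Normal_Form.Matrix"
    "Jordan_Normal_Form.Gauss_Jordan_Elimination"
    "Jordan_Normal_Form.DL_Submatrix"
begin

definition symmetric_mat :: "'a mat \<Rightarrow> bool" where
  "symmetric_mat M \<longleftrightarrow> M\<^sup>T = M"

definition pos_def_mat :: "nat \<Rightarrow> real mat \<Rightarrow> bool" where
  "pos_def_mat n M \<longleftrightarrow> M \<in> carrier_mat n n \<and> symmetric_mat M \<and>
     (\<forall>x \<in> carrier_vec n. x \<noteq> 0\<^sub>v n \<longrightarrow> x \<bullet> (M *\<^sub>v x) > 0)"

definition pos_semidef_mat :: "nat \<Rightarrow> real mat \<Rightarrow> bool" where
  "pos_semidef_mat n M \<longleftrightarrow> M \<in> carrier_mat n n \<and> symmetric_mat M \<and>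
     (\<forall>x \<in> carrier_vec n. x \<bullet> (M *\<^sub>v x) \<ge> 0)"

(* Matrices of different sizes share one type, so there is no zero matrix to start an
   ordinary sum from; the size is therefore passed explicitly. *)
definition mat_lincomb ::
  "nat \<Rightarrow> nat \<Rightarrow> nat set \<Rightarrow> (nat \<Rightarrow> real) \<Rightarrow> (nat \<Rightarrow> real mat) \<Rightarrow> real mat" where
  "mat_lincomb nr nc I c M = mat nr nc (\<lambda>(r, s). \<Sum>i\<in>I. c i * M i $$ (r, s))"

definition mat_congr :: "real mat \<Rightarrow> real mat \<Rightarrow> real mat" where
  "mat_congr P M = P\<^sup>T * M * P"

definition sim_diag_congr :: "nat \<Rightarrow> nat set \<Rightarrow> (nat \<Rightarrow> real mat) \<Rightarrow> bool" where
  "sim_diag_congr n I M \<longleftrightarrow>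
     (\<exists>P \<in> carrier_mat n n. invertible_mat P \<and> (\<forall>i\<in>I. diagonal_mat (mat_congr P (M i))))"

definition diag_supp :: "real mat \<Rightarrow> nat set" where
  "diag_supp D = {i. i < dim_row D \<and> D $$ (i, i) \<noteq> 0}"

(* V diagonalizes all M i (i \<in> I) by congruence, and the diagonal positions that vanish for
   every i are exactly q, ..., r - 1 (rows and columns are numbered from 0). *)
definition ordered_sd_witness ::
  "nat \<Rightarrow> nat set \<Rightarrow> (nat \<Rightarrow> real mat) \<Rightarrow> nat \<Rightarrow> real mat \<Rightarrow> bool" where
  "ordered_sd_witness r I M q V \<longleftrightarrow>
     V \<in> carrier_mat r r \<and> invertible_mat V \<and>
     (\<forall>i\<in>I. diagonal_mat (mat_congr V (M i))) \<and>
     q \<le> r \<and>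
     (\<forall>j<r. (\<exists>i\<in>I. mat_congr V (M i) $$ (j, j) \<noteq> 0) \<longleftrightarrow> j < q)"

(* weight_search m q B j mu D: the procedure run on the q x q diagonal matrices
   B 1, ..., B (m - 1) can be in a state where mu 1, ..., mu j have been treated and
   D = (\<Sum>i\<le>j. mu i B i). The singularity test is applied only to a newly computed D, whence the
   alternative j = 1; q > 0 is understood. *)
inductive weight_search ::
  "nat \<Rightarrow> nat \<Rightarrow> (nat \<Rightarrow> real mat) \<Rightarrow> nat \<Rightarrow> (nat \<Rightarrow> real) \<Rightarrow> real mat \<Rightarrow> bool"
  for m q :: nat and B :: "nat \<Rightarrow> real mat" where
  start: "weight_search m q B 1 (\<lambda>i. if i = 1 then 1 else 0) (B 1)"
| step: "weight_search m q B j mu D \<Longrightarrow> j \<le> m - 2 \<Longrightarrow> j = 1 \<or> \<not> invertible_mat D \<Longrightarrow>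
    s \<in> {0..q} \<Longrightarrow> w = real s / real q \<Longrightarrow> D' = D + w \<cdot>\<^sub>m B (j + 1) \<Longrightarrow>
    diag_supp D' = diag_supp D \<union> diag_supp (B (j + 1)) \<Longrightarrow>
    weight_search m q B (j + 1) (mu(j + 1 := w)) D'"

(* mu is a possible final outcome. Stopping at once when B 1 is already nonsingular gives the same
   mu as choosing s = 0 in the first step, so it adds no outcome. For q = 0 every mu is allowed. *)
definition search_weights :: "nat \<Rightarrow> nat \<Rightarrow> (nat \<Rightarrow> real mat) \<Rightarrow> (nat \<Rightarrow> real) \<Rightarrow> bool" where
  "search_weights m q B mu \<longleftrightarrow>
     q = 0 \<or> (\<exists>j D. weight_search m q B j mu D \<and> (j = m - 1 \<or> invertible_mat D))"

end

theory Submission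
  imports
    Defs
    "Jordan_Normal_Form.Char_Poly"
    "HOL-Computational_Algebra.Fundamental_Theorem_Algebra"
begin

text \<open>
The semidefinite combination can be brought to the form \<open>J = diag(I, 0)\<close>, and everything rests
on how rigid a congruence becomes once it keeps \<open>J\<close> diagonal. If \<open>P\<^sup>T J P\<close> is diagonal, then after
permuting and rescaling its columns \<open>P\<close> is block lower triangular with an orthogonal upper left
block \<open>U\<close> (lemma \<open>partial_identity_congruence_block_form\<close>), so it factors as a shear
\<open>((I, 0), (- W\<^sup>T, I))\<close> followed by the block diagonal matrix \<open>diag(U, V)\<close>. The shear turns a symmetric
matrix \<open>((M, N), (N\<^sup>T, K))\<close> into one with off-diagonal block \<open>N - W K\<close>, and \<open>diag(U, V)\<close> cannot
repair a nonzero off-diagonal block. Hence \<open>J\<close> and the matrices \<open>((M\<^sub>i, N\<^sub>i), (N\<^sub>i\<^sup>T, K\<^sub>i))\<close> are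
simultaneously diagonalizable via congruence exactly when some \<open>W\<close>, common to all \<open>i\<close>, satisfies
\<open>N\<^sub>i = W K\<^sub>i\<close>, the \<open>K\<^sub>i\<close> are simultaneously diagonalizable via congruence, and one orthogonal \<open>U\<close>
diagonalizes all symmetric matrices \<open>M\<^sub>i - W N\<^sub>i\<^sup>T\<close>. The last condition means that these matrices
commute, by the spectral theorem for commuting families.

Once the \<open>K\<^sub>i\<close> are diagonal, \<open>N\<^sub>i = W K\<^sub>i\<close> is a condition on single columns: columns of \<open>N\<^sub>i\<close> at
positions where all \<open>K\<^sub>i\<close> vanish must be zero (condition 1), and at the other positions
\<open>N\<^sub>i = W K\<^sub>i\<close> for all \<open>i\<close> forces the same relation for the weighted sums, \<open>D\<^sub>2 = W D\<^sub>3\<close>. As \<open>D\<^sub>3\<close> is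
nonsingular, the only candidate for the relevant columns of \<open>W\<close> is \<open>D\<^sub>2 D\<^sub>3\<^sup>-\<^sup>1\<close>; this makes the
existence of \<open>W\<close> equivalent to condition 2 and turns \<open>M\<^sub>i - W N\<^sub>i\<^sup>T\<close> into the matrices of
condition 3 (lemmas \<open>factor_through_weights\<close> and \<open>simultaneous_block_diagonalization_iff\<close>). The weight
search provides a nonsingular \<open>D\<^sub>3\<close> because it maintains the supports it has collected.

The equivalence of (a) and (b) holds because a congruence that diagonalizes some matrices diagonalizes
their linear combinations, and each of the two families consists of combinations of the other.
\<close>

section \<open>Underdetermined linear systems\<close>

text \<open>
Padding the system with zero equations to a square one makes its determinant vanish.
\<close>

lemma underdetermined_system:
  fixes a :: "nat \<Rightarrow> nat \<Rightarrow> real"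
  assumes "M < N"
  obtains c where "\<exists>k<N. c k \<noteq> 0" "\<And>i. i < M \<Longrightarrow> (\<Sum>k<N. a i k * c k) = 0"
proof -
  define X where "X = mat N N (\<lambda>(i, k). if i < M then a i k else 0)"
  have X: "X \<in> carrier_mat N N" by (simp add: X_def)
  have "X = mat\<^sub>r N N (\<lambda>i. if i = N - 1 then 0\<^sub>v N else row X i)"
    using assms by (intro eq_matI) (auto simp: X_def)
  moreover have "det (mat\<^sub>r N N (\<lambda>i. if i = N - 1 then 0\<^sub>v N else row X i)) = 0"
    using assms X by (intro det_row_0) auto
  ultimately have "det X = 0" by simp
  then obtain v where v: "v \<in> carrier_vec N" "v \<noteq> 0\<^sub>v N" "X *\<^sub>v v = 0\<^sub>v N"
    using det_0_iff_vec_prod_zero_field[OF X] by auto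
  show thesis
  proof
    show "\<exists>k<N. v $ k \<noteq> 0" using v(1,2) by (auto intro: eq_vecI)
    fix i assume "i < M"
    then have "(X *\<^sub>v v) $ i = (\<Sum>k<N. a i k * v $ k)"
      using assms v(1) X by (auto simp: X_def scalar_prod_def atLeast0LessThan intro!: sum.cong)
    then show "(\<Sum>k<N. a i k * v $ k) = 0"
      using v(3) \<open>i < M\<close> assms by simp
  qed
qed

text \<open>
This replaces rank arguments when index sets are compared with block sizes below: a kernel vector of
the right factor would be killed by the identity.
\<close>

lemma left_invertible_rows_le_cols:
  fixes A B :: "real mat"
  assumes A: "A \<in> carrier_mat a b" and B: "B \<in> carrier_mat b a" and AB: "A * B = 1\<^sub>m a"
  shows "a \<le> b"
proof (rule ccontr)
  assume "\<not> a \<le> b"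
  then have "b < a" by simp
  then obtain c where c: "\<exists>k<a. c k \<noteq> 0" "\<And>i. i < b \<Longrightarrow> (\<Sum>k<a. B $$ (i, k) * c k) = 0"
    using underdetermined_system[of b a "\<lambda>i k. B $$ (i, k)"] by blast
  define v where "v = vec a c"
  have v: "v \<in> carrier_vec a" by (simp add: v_def)
  have "B *\<^sub>v v = 0\<^sub>v b"
    using c(2) B by (intro eq_vecI) (auto simp: v_def scalar_prod_def atLeast0LessThan)
  then have "v = 0\<^sub>v a"
    using assoc_mult_mat_vec[OF A B v] AB v A by auto
  then show False using c(1) by (auto simp: v_def vec_eq_iff)
qed

section \<open>Common eigenvectors of commuting symmetric matrices\<close>

text \<open>
The vector \<open>f(A) v\<close>, evaluated by Horner's rule, so that only vectors occur and no algebra of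
matrix polynomials has to be set up.
\<close>

definition poly_mat_vec :: "real mat \<Rightarrow> real vec \<Rightarrow> real poly \<Rightarrow> real vec" where
  "poly_mat_vec A v f = fold_coeffs (\<lambda>a u. a \<cdot>\<^sub>v v + A *\<^sub>v u) f (0\<^sub>v (dim_vec v))"

context
  fixes A :: "real mat" and v :: "real vec" and p :: nat
  assumes A: "A \<in> carrier_mat p p" and v: "v \<in> carrier_vec p"
begin

lemma poly_mat_vec_0: "poly_mat_vec A v 0 = 0\<^sub>v p"
  using v by (simp add: poly_mat_vec_def)

lemma poly_mat_vec_pCons: "poly_mat_vec A v (pCons a f) = a \<cdot>\<^sub>v v + A *\<^sub>v poly_mat_vec A v f"
proof (cases "a = 0 \<and> f = 0")
  case True
  then show ?thesis using A v by (auto simp: poly_mat_vec_0)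
next
  case False
  then show ?thesis
    by (cases "a = 0") (auto simp: poly_mat_vec_def)
qed

lemma poly_mat_vec_carrier: "poly_mat_vec A v f \<in> carrier_vec p"
  by (induction f) (use A v in \<open>auto simp: poly_mat_vec_0 poly_mat_vec_pCons\<close>)

lemma poly_mat_vec_add: "poly_mat_vec A v (f + g) = poly_mat_vec A v f + poly_mat_vec A v g"
proof (induction f g rule: poly_induct2)
  case (pCons a f b g)
  have "poly_mat_vec A v (pCons a f + pCons b g) =
      (a + b) \<cdot>\<^sub>v v + (A *\<^sub>v poly_mat_vec A v f + A *\<^sub>v poly_mat_vec A v g)"
    using pCons A v poly_mat_vec_carrier by (simp add: poly_mat_vec_pCons mult_add_distrib_mat_vec[of _ p p])
  also have "\<dots> = (a \<cdot>\<^sub>v v + A *\<^sub>v poly_mat_vec A v f) + (b \<cdot>\<^sub>v v + A *\<^sub>v poly_mat_vec A v g)"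
    using A v poly_mat_vec_carrier[of f] poly_mat_vec_carrier[of g]
    by (intro eq_vecI) (auto simp: algebra_simps)
  finally show ?case by (simp add: poly_mat_vec_pCons)
qed (simp_all add: poly_mat_vec_0)

lemma poly_mat_vec_smult: "poly_mat_vec A v (smult c f) = c \<cdot>\<^sub>v poly_mat_vec A v f"
proof (induction f)
  case (pCons a f)
  then show ?case using A v poly_mat_vec_carrier[of f]
    by (intro eq_vecI) (auto simp: poly_mat_vec_pCons algebra_simps mult_mat_vec[of _ p p])
qed (auto simp: poly_mat_vec_0)

lemma poly_mat_vec_sum_monom: "poly_mat_vec A v (\<Sum>k\<in>S. monom (c k) k) = vec p (\<lambda>i. \<Sum>k\<in>S. c k * poly_mat_vec A v (monom 1 k) $ i)"
proof (induction S rule: infinite_finite_induct)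
  case (insert k S)
  have "monom (c k) k = smult (c k) (monom 1 k)" by (simp add: smult_monom)
  with insert show ?case using poly_mat_vec_carrier[of "monom 1 k"]
    by (intro eq_vecI) (auto simp: poly_mat_vec_add poly_mat_vec_smult)
qed (auto simp: poly_mat_vec_0)

lemma poly_mat_vec_mem:
  assumes "0\<^sub>v p \<in> W"
    and "\<And>c x. x \<in> W \<Longrightarrow> c \<cdot>\<^sub>v x \<in> W"
    and "\<And>x y. x \<in> W \<Longrightarrow> y \<in> W \<Longrightarrow> x + y \<in> W"
    and "\<And>x. x \<in> W \<Longrightarrow> A *\<^sub>v x \<in> W" and "v \<in> W"
  shows "poly_mat_vec A v f \<in> W"
  by (induction f) (use assms in \<open>auto simp: poly_mat_vec_0 poly_mat_vec_pCons\<close>)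

lemma poly_mat_vec_linear_mult:
  "poly_mat_vec A v ([:- a, 1:] * g) = A *\<^sub>v poly_mat_vec A v g - a \<cdot>\<^sub>v poly_mat_vec A v g"
proof -
  have "[:- a, 1:] * g = pCons 0 g + smult (- a) g" by simp
  then show ?thesis using A v poly_mat_vec_carrier[of g]
    unfolding \<open>[:- a, 1:] * g = _\<close> poly_mat_vec_add poly_mat_vec_smult poly_mat_vec_pCons
    by (intro eq_vecI) auto
qed

text \<open>
The vectors \<open>v, A v, \<dots>, A\<^sup>p v\<close> are linearly dependent.
\<close>

lemma poly_mat_vec_annihilator: "\<exists>f. f \<noteq> 0 \<and> poly_mat_vec A v f = 0\<^sub>v p"
proof -
  obtain c where c: "\<exists>k<Suc p. c k \<noteq> 0"
      "\<And>i. i < p \<Longrightarrow> (\<Sum>k<Suc p. poly_mat_vec A v (monom 1 k) $ i * c k) = 0"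
    using underdetermined_system[of p "Suc p" "\<lambda>i k. poly_mat_vec A v (monom 1 k) $ i"] by auto
  define f where "f = (\<Sum>k<Suc p. monom (c k) k)"
  have "coeff f k = (if k < Suc p then c k else 0)" for k
    by (simp add: f_def coeff_sum del: sum.lessThan_Suc)
  then have "f \<noteq> 0" using c(1) by (metis coeff_0)
  moreover have "poly_mat_vec A v f = 0\<^sub>v p"
    unfolding f_def poly_mat_vec_sum_monom using c(2)
    by (intro eq_vecI) (auto simp del: sum.lessThan_Suc simp: mult.commute)
  ultimately show ?thesis by blast
qed

end

text \<open>
A complex root \<open>a + i b\<close> of a real polynomial gives the real factor \<open>x - a\<close> if \<open>b = 0\<close>, and
\<open>(x - a)\<^sup>2 + b\<^sup>2\<close> otherwise. The quadratic factor is kept in this expanded form because it acts on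
vectors as \<open>(A - a)\<^sup>2 + b\<^sup>2\<close>.
\<close>

lemma real_poly_linear_or_quadratic_factor:
  fixes f :: "real poly"
  assumes "degree f > 0"
  shows "\<exists>a b g. f = [:- a, 1:] * g \<or>
           b \<noteq> 0 \<and> f = ([:- a, 1:] * ([:- a, 1:] * g)) + smult (b\<^sup>2) g"
proof -
  interpret h: map_poly_comm_ring_hom complex_of_real ..
  let ?F = "map_poly complex_of_real f"
  have "degree ?F > 0" using assms by (simp add: degree_map_poly)
  then obtain z where z: "poly ?F z = 0"
    using fundamental_theorem_of_algebra[of ?F] by (auto simp: constant_degree)
  show ?thesis
  proof (cases "Im z = 0")
    case True
    then have "z = complex_of_real (Re z)" by (simp add: complex_eq_iff)
    moreover have "poly ?F (complex_of_real x) = complex_of_real (poly f x)" for x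
      by (induction f) (auto simp: map_poly_pCons)
    ultimately have "poly f (Re z) = 0" using z by (metis of_real_eq_0_iff)
    then show ?thesis by (meson dvdE poly_eq_0_iff_dvd)
  next
    case False
    let ?a = "Re z" and ?b = "Im z"
    define q where "q = [:?a\<^sup>2 + ?b\<^sup>2, - 2 * ?a, 1:]"
    have q0: "q \<noteq> 0" "degree q = 2" by (auto simp: q_def)
    have Q: "poly (map_poly complex_of_real q) z = 0"
      by (simp add: q_def map_poly_pCons complex_eq_iff power2_eq_square algebra_simps)
    define r where "r = f mod q"
    have "degree r < 2" using degree_mod_less[OF q0(1), of f] q0(2) by (auto simp: r_def)
    then have "r = [:coeff r 0, coeff r 1:]"
      by (intro poly_eqI) (auto simp: coeff_pCons coeff_eq_0 split: nat.splits)
    then obtain c d where r: "r = [:c, d:]" by blast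
    have "f = q * (f div q) + r" by (simp add: r_def)
    then have "?F = map_poly complex_of_real q * map_poly complex_of_real (f div q) + map_poly complex_of_real r"
      by (metis h.hom_add h.hom_mult)
    then have "poly (map_poly complex_of_real r) z = 0" using z Q by simp
    moreover have "map_poly complex_of_real r = [:complex_of_real c, complex_of_real d:]"
      unfolding r by (intro poly_eqI) (auto simp: coeff_map_poly coeff_pCons split: nat.splits)
    ultimately have "c = 0 \<and> d = 0" using False by (auto simp: complex_eq_iff)
    then have "f = q * (f div q)" using \<open>f = q * (f div q) + r\<close> r by simp
    also have "\<dots> = ([:- ?a, 1:] * ([:- ?a, 1:] * (f div q))) + smult (?b\<^sup>2) (f div q)"
    proof -
      have "q = [:- ?a, 1:] * [:- ?a, 1:] + [:?b\<^sup>2:]" by (simp add: q_def power2_eq_square)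
      then have "q * g = [:- ?a, 1:] * ([:- ?a, 1:] * g) + smult (?b\<^sup>2) g" for g
        by (simp only: distrib_right mult.assoc) simp
      then show ?thesis .
    qed
    finally show ?thesis using False by blast
  qed
qed

lemma symmetric_mat_scalar_prod:
  fixes A :: "real mat"
  assumes A: "A \<in> carrier_mat p p" and sym: "A\<^sup>T = A"
    and x: "x \<in> carrier_vec p" and y: "y \<in> carrier_vec p"
  shows "x \<bullet> (A *\<^sub>v y) = (A *\<^sub>v x) \<bullet> y"
proof -
  have "x \<bullet> (A *\<^sub>v y) = (\<Sum>i<p. \<Sum>j<p. x $ i * A $$ (i, j) * y $ j)"
    using assms by (simp add: scalar_prod_def atLeast0LessThan sum_distrib_left mult.assoc)
  also have "\<dots> = (\<Sum>j<p. \<Sum>i<p. x $ i * A $$ (i, j) * y $ j)" by (rule sum.swap)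
  also have "\<dots> = (\<Sum>j<p. \<Sum>i<p. x $ i * A $$ (j, i) * y $ j)"
  proof (intro sum.cong refl)
    fix i j assume "i \<in> {..<p}" "j \<in> {..<p}"
    then have "A $$ (i, j) = A $$ (j, i)" using sym A by (metis carrier_matD index_transpose_mat(1) lessThan_iff)
    then show "x $ i * A $$ (i, j) * y $ j = x $ i * A $$ (j, i) * y $ j" by simp
  qed
  also have "\<dots> = (A *\<^sub>v x) \<bullet> y"
    using assms by (simp add: scalar_prod_def atLeast0LessThan sum_distrib_left sum_distrib_right mult.commute mult.left_commute)
  finally show ?thesis .
qed

lemma real_scalar_prod_self_pos:
  fixes x :: "real vec"
  assumes "x \<in> carrier_vec p" "x \<noteq> 0\<^sub>v p"
  shows "x \<bullet> x > 0"
proof -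
  obtain i where "i < p" "x $ i \<noteq> 0" using assms by (metis carrier_vecD eq_vecI index_zero_vec)
  then show ?thesis using assms
    unfolding scalar_prod_def by (intro sum_pos2[of _ i]) (auto simp: zero_less_mult_iff linorder_neq_iff)
qed

text \<open>
Take \<open>f \<noteq> 0\<close> of least degree with \<open>f(A) v = 0\<close> and split off a factor of degree one or two,
leaving a cofactor \<open>g\<close> with \<open>w = g(A) v \<noteq> 0\<close>, which lies in \<open>W\<close>. A linear factor makes \<open>w\<close> an
eigenvector. For a quadratic factor, symmetry of \<open>A\<close> gives
\<open>0 = \<langle>w, ((A - a)\<^sup>2 + b\<^sup>2) w\<rangle> = |(A - a) w|\<^sup>2 + b\<^sup>2 |w|\<^sup>2\<close>, so this case cannot occur.
\<close>

lemma symmetric_mat_eigenvector_in_invariant_subspace: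
  fixes A :: "real mat"
  assumes A: "A \<in> carrier_mat p p" and sym: "A\<^sup>T = A"
    and W: "W \<subseteq> carrier_vec p" "0\<^sub>v p \<in> W"
      "\<And>c x. x \<in> W \<Longrightarrow> c \<cdot>\<^sub>v x \<in> W" "\<And>x y. x \<in> W \<Longrightarrow> y \<in> W \<Longrightarrow> x + y \<in> W"
    and inv: "\<And>x. x \<in> W \<Longrightarrow> A *\<^sub>v x \<in> W"
    and v: "v \<in> W" "v \<noteq> 0\<^sub>v p"
  shows "\<exists>w \<in> W. \<exists>a. w \<noteq> 0\<^sub>v p \<and> A *\<^sub>v w = a \<cdot>\<^sub>v w"
proof -
  have v': "v \<in> carrier_vec p" using W v by auto
  note [simp] = poly_mat_vec_carrier[OF A v']
  let ?P = "\<lambda>f. f \<noteq> 0 \<and> poly_mat_vec A v f = 0\<^sub>v p"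
  obtain f0 where "?P f0" using poly_mat_vec_annihilator[OF A v'] by blast
  from ex_has_least_nat[of ?P, OF this, of degree]
  obtain f where f: "f \<noteq> 0" "poly_mat_vec A v f = 0\<^sub>v p"
    and fmin: "\<And>g. g \<noteq> 0 \<Longrightarrow> poly_mat_vec A v g = 0\<^sub>v p \<Longrightarrow> degree f \<le> degree g"
    by auto
  have "degree f > 0"
  proof (rule ccontr)
    assume "\<not> degree f > 0"
    then obtain c where c: "f = [:c:]" by (meson degree_eq_zeroE gr0I)
    then have "c \<noteq> 0" using f by auto
    have "A *\<^sub>v 0\<^sub>v p = 0\<^sub>v p" using A by (intro eq_vecI) auto
    then have "c \<cdot>\<^sub>v v = 0\<^sub>v p"
      using f(2) v' by (simp add: c poly_mat_vec_pCons[OF A v'] poly_mat_vec_0[OF A v'])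
    then have "c * v $ i = 0" if "i < p" for i
      using v' that by (metis carrier_vecD index_smult_vec(1) index_zero_vec(1))
    then have "v = 0\<^sub>v p" using \<open>c \<noteq> 0\<close> v' by (intro eq_vecI) auto
    then show False using v by simp
  qed
  then obtain a b g where g: "f = [:- a, 1:] * g \<or>
      b \<noteq> 0 \<and> f = ([:- a, 1:] * ([:- a, 1:] * g)) + smult (b\<^sup>2) g"
    using real_poly_linear_or_quadratic_factor by blast
  have "g \<noteq> 0" using g f by auto
  moreover have "degree g < degree f"
  proof -
    have d: "degree ([:- a, 1:] * h) = Suc (degree h)" if "h \<noteq> 0" for h :: "real poly"
      using that by (subst degree_mult_eq) auto
    have d2: "degree ([:- a, 1:] * ([:- a, 1:] * g)) = Suc (Suc (degree g))"
    proof -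
      have "[:- a, 1:] * g \<noteq> 0" by (simp only: mult_eq_0_iff) (simp add: \<open>g \<noteq> 0\<close>)
      from d[OF this] d[OF \<open>g \<noteq> 0\<close>] show ?thesis by (simp only:)
    qed
    moreover have "degree (smult (b\<^sup>2) g) < Suc (Suc (degree g))"
      using degree_smult_le[of "b\<^sup>2" g] by linarith
    ultimately show ?thesis using g d[OF \<open>g \<noteq> 0\<close>]
      by (metis degree_add_eq_left less_Suc_eq)
  qed
  ultimately have w0: "poly_mat_vec A v g \<noteq> 0\<^sub>v p" using fmin[of g] by auto
  define w where "w = poly_mat_vec A v g"
  have wW: "w \<in> W" unfolding w_def by (rule poly_mat_vec_mem[OF A v' W(2-4) inv v(1)])
  then have w: "w \<in> carrier_vec p" using W by auto
  define u where "u = poly_mat_vec A v ([:- a, 1:] * g)"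
  have u: "u = A *\<^sub>v w - a \<cdot>\<^sub>v w" unfolding u_def w_def by (rule poly_mat_vec_linear_mult[OF A v'])
  have u': "u \<in> carrier_vec p" by (simp add: u_def)
  \<comment> \<open>The quadratic case is refuted by computing the inner product of \<open>w\<close> with \<open>f(A) v = 0\<close>.\<close>
  have "u = 0\<^sub>v p"
  proof (rule disjE[OF g])
    assume "b \<noteq> 0 \<and> f = [:- a, 1:] * ([:- a, 1:] * g) + smult (b\<^sup>2) g"
    then have b: "b \<noteq> 0" and fe: "f = [:- a, 1:] * ([:- a, 1:] * g) + smult (b\<^sup>2) g" by blast+
    have eq: "poly_mat_vec A v f = (A *\<^sub>v u - a \<cdot>\<^sub>v u) + b\<^sup>2 \<cdot>\<^sub>v w"
      unfolding u_def w_def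
      by (simp only: fe poly_mat_vec_add[OF A v'] poly_mat_vec_smult[OF A v'] poly_mat_vec_linear_mult[OF A v'])
    have "w \<bullet> ((A *\<^sub>v u - a \<cdot>\<^sub>v u) + b\<^sup>2 \<cdot>\<^sub>v w) = 0"
      unfolding eq[symmetric] f(2) using w by simp
    also have "w \<bullet> ((A *\<^sub>v u - a \<cdot>\<^sub>v u) + b\<^sup>2 \<cdot>\<^sub>v w) = w \<bullet> (A *\<^sub>v u) - a * (w \<bullet> u) + b\<^sup>2 * (w \<bullet> w)"
      using w u' A by (simp add: scalar_prod_add_distrib[of _ p] scalar_prod_minus_distrib[of _ p])
    also have "w \<bullet> (A *\<^sub>v u) - a * (w \<bullet> u) = u \<bullet> u"
    proof -
      have "(A *\<^sub>v w - a \<cdot>\<^sub>v w) \<bullet> u = (A *\<^sub>v w) \<bullet> u - (a \<cdot>\<^sub>v w) \<bullet> u"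
        using w u' A by (intro minus_scalar_prod_distrib[of _ p]) auto
      also have "(a \<cdot>\<^sub>v w) \<bullet> u = a * (w \<bullet> u)" using w u' by (rule smult_scalar_prod_distrib)
      finally show ?thesis using symmetric_mat_scalar_prod[OF A sym w u'] by (simp only: u[symmetric])
    qed
    finally have "u \<bullet> u + b\<^sup>2 * (w \<bullet> w) = 0" .
    moreover have "w \<bullet> w > 0" using real_scalar_prod_self_pos[OF w] w0 by (simp add: w_def)
    then have "b\<^sup>2 * (w \<bullet> w) > 0" using b by simp
    ultimately have "u \<bullet> u < 0" by linarith
    then show ?thesis using real_scalar_prod_self_pos[OF u'] by fastforce
  qed (use f(2) in \<open>simp add: u_def\<close>)
  then have "(A *\<^sub>v w - a \<cdot>\<^sub>v w) $ i = 0" if "i < p" for i using that by (simp add: u[symmetric])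
  then have "A *\<^sub>v w = a \<cdot>\<^sub>v w" using w A by (intro eq_vecI) auto
  then show ?thesis using wW w0 unfolding w_def by blast
qed

text \<open>
Matrices commuting with \<open>R k\<close> preserve the eigenspaces of \<open>R k\<close>, so the subspace can be cut down to an
eigenspace of one matrix after another. This is why the single-matrix version is stated inside an
invariant subspace.
\<close>

lemma common_eigenvector_in_invariant_subspace:
  fixes R :: "'i \<Rightarrow> real mat"
  assumes "finite I"
    and "\<And>i. i \<in> I \<Longrightarrow> R i \<in> carrier_mat p p" and "\<And>i. i \<in> I \<Longrightarrow> (R i)\<^sup>T = R i"
    and "\<And>i j. i \<in> I \<Longrightarrow> j \<in> I \<Longrightarrow> R i * R j = R j * R i"
    and "W \<subseteq> carrier_vec p" "0\<^sub>v p \<in> W"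
      "\<And>c x. x \<in> W \<Longrightarrow> c \<cdot>\<^sub>v x \<in> W" "\<And>x y. x \<in> W \<Longrightarrow> y \<in> W \<Longrightarrow> x + y \<in> W"
    and "\<And>i x. i \<in> I \<Longrightarrow> x \<in> W \<Longrightarrow> R i *\<^sub>v x \<in> W"
    and "v \<in> W" "v \<noteq> 0\<^sub>v p"
  shows "\<exists>w \<in> W. w \<noteq> 0\<^sub>v p \<and> (\<forall>i\<in>I. \<exists>a. R i *\<^sub>v w = a \<cdot>\<^sub>v w)"
  using assms
proof (induction I arbitrary: W v rule: finite_induct)
  case empty
  then show ?case by auto
next
  case (insert k I)
  have R: "R i \<in> carrier_mat p p" if "i \<in> insert k I" for i using insert.prems(1) that .
  have Wc: "x \<in> carrier_vec p" if "x \<in> W" for x using insert.prems(4) that by auto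
  obtain w a where w: "w \<in> W" "w \<noteq> 0\<^sub>v p" "R k *\<^sub>v w = a \<cdot>\<^sub>v w"
    using symmetric_mat_eigenvector_in_invariant_subspace[of "R k" p W v, OF insert.prems(1)[of k] insert.prems(2)[of k]
      insert.prems(4-7) insert.prems(8)[of k] insert.prems(9,10)] by blast
  define E where "E = {x \<in> W. R k *\<^sub>v x = a \<cdot>\<^sub>v x}"
  have "\<exists>x\<in>E. x \<noteq> 0\<^sub>v p \<and> (\<forall>i\<in>I. \<exists>a. R i *\<^sub>v x = a \<cdot>\<^sub>v x)"
  proof (rule insert.IH)
    show "R i \<in> carrier_mat p p" if "i \<in> I" for i using R that by simp
    show "(R i)\<^sup>T = R i" if "i \<in> I" for i using insert.prems(2)[of i] that by simp
    show "R i * R j = R j * R i" if "i \<in> I" "j \<in> I" for i j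
      using insert.prems(3)[of i j] that by simp
    show "E \<subseteq> carrier_vec p" using Wc by (auto simp: E_def)
    show "0\<^sub>v p \<in> E" using insert.prems(5) R[of k] by (auto simp: E_def intro!: eq_vecI)
    show "c \<cdot>\<^sub>v x \<in> E" if "x \<in> E" for c x
      using that insert.prems(6) Wc[of x] R[of k]
      by (auto simp: E_def mult_mat_vec[of _ p p] smult_smult_assoc mult.commute)
    show "x + y \<in> E" if "x \<in> E" "y \<in> E" for x y
      using that insert.prems(7) Wc[of x] Wc[of y] R[of k]
      by (auto simp: E_def mult_add_distrib_mat_vec[of _ p p] smult_add_distrib_vec[of _ p])
    show "R i *\<^sub>v x \<in> E" if i: "i \<in> I" and x: "x \<in> E" for i x
    proof -
      have x': "x \<in> W" "x \<in> carrier_vec p" "R k *\<^sub>v x = a \<cdot>\<^sub>v x" using x Wc by (auto simp: E_def)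
      have "R k *\<^sub>v (R i *\<^sub>v x) = (R k * R i) *\<^sub>v x"
        using R[of k] R[of i] i x' by (simp add: assoc_mult_mat_vec[of _ p p _ p])
      also have "\<dots> = (R i * R k) *\<^sub>v x" using insert.prems(3)[of k i] i by simp
      also have "\<dots> = R i *\<^sub>v (a \<cdot>\<^sub>v x)"
        using R[of k] R[of i] i x' by (simp add: assoc_mult_mat_vec[of _ p p _ p])
      also have "\<dots> = a \<cdot>\<^sub>v (R i *\<^sub>v x)" using R[of i] i x' by (simp add: mult_mat_vec[of _ p p])
      finally show ?thesis using insert.prems(8)[of i x] i x' by (simp add: E_def)
    qed
    show "w \<in> E" using w by (simp add: E_def)
  qed (rule w(2))
  then show ?case by (auto simp: E_def)
qed

text \<open>
The orthogonal complement of the eigenvectors found so far is invariant because the matrices are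
symmetric, and it is nonzero as long as there are fewer than \<open>p\<close> of them.
\<close>

lemma orthonormal_common_eigenvectors:
  fixes R :: "'i \<Rightarrow> real mat"
  assumes fin: "finite I"
    and R: "\<And>i. i \<in> I \<Longrightarrow> R i \<in> carrier_mat p p" and sym: "\<And>i. i \<in> I \<Longrightarrow> (R i)\<^sup>T = R i"
    and comm: "\<And>i j. i \<in> I \<Longrightarrow> j \<in> I \<Longrightarrow> R i * R j = R j * R i"
  shows "d \<le> p \<Longrightarrow> \<exists>u. (\<forall>k<d. u k \<in> carrier_vec p) \<and>
    (\<forall>k<d. \<forall>l<d. u k \<bullet> u l = (if k = l then 1 else (0::real))) \<and>
    (\<forall>i\<in>I. \<forall>k<d. \<exists>a. R i *\<^sub>v u k = a \<cdot>\<^sub>v u k)"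
proof (induction d)
  case 0
  then show ?case by auto
next
  case (Suc d)
  from Suc.prems have "d \<le> p" by simp
  from Suc.IH[OF this] obtain u where "(\<forall>k<d. u k \<in> carrier_vec p) \<and>
    (\<forall>k<d. \<forall>l<d. u k \<bullet> u l = (if k = l then 1 else (0::real))) \<and>
    (\<forall>i\<in>I. \<forall>k<d. \<exists>a. R i *\<^sub>v u k = a \<cdot>\<^sub>v u k)" ..
  then have u: "\<And>k. k < d \<Longrightarrow> u k \<in> carrier_vec p"
    and orth: "\<And>k l. k < d \<Longrightarrow> l < d \<Longrightarrow> u k \<bullet> u l = (if k = l then 1 else (0::real))"
    and eig: "\<And>i k. i \<in> I \<Longrightarrow> k < d \<Longrightarrow> \<exists>a. R i *\<^sub>v u k = a \<cdot>\<^sub>v u k"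
    by blast+
  define W where "W = {x \<in> carrier_vec p. \<forall>k<d. u k \<bullet> x = 0}"
  obtain c where c: "\<exists>k<p. c k \<noteq> 0" "\<And>i. i < d \<Longrightarrow> (\<Sum>k<p. u i $ k * c k) = 0"
    using underdetermined_system[of d p "\<lambda>i k. u i $ k"] Suc.prems by auto
  have "\<exists>w \<in> W. w \<noteq> 0\<^sub>v p \<and> (\<forall>i\<in>I. \<exists>a. R i *\<^sub>v w = a \<cdot>\<^sub>v w)"
  proof (rule common_eigenvector_in_invariant_subspace[OF fin R sym comm])
    show "R i *\<^sub>v x \<in> W" if i: "i \<in> I" and x: "x \<in> W" for i x
    proof -
      have x': "x \<in> carrier_vec p" using x by (simp add: W_def)
      have "u k \<bullet> (R i *\<^sub>v x) = 0" if k: "k < d" for k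
      proof -
        obtain a where "R i *\<^sub>v u k = a \<cdot>\<^sub>v u k" using eig i k by blast
        then have "u k \<bullet> (R i *\<^sub>v x) = a * (u k \<bullet> x)"
          using symmetric_mat_scalar_prod[OF R sym u x'] i k u x' by simp
        then show ?thesis using x k by (simp add: W_def)
      qed
      then show ?thesis using R[OF i] x' by (simp add: W_def)
    qed
    show "vec p c \<in> W"
      using c(2) by (auto simp: W_def scalar_prod_def atLeast0LessThan)
    show "vec p c \<noteq> 0\<^sub>v p" using c(1) by (auto simp: vec_eq_iff)
  qed (use u in \<open>auto simp: W_def scalar_prod_add_distrib[of _ p]\<close>)
  then obtain w where w: "w \<in> carrier_vec p" "w \<noteq> 0\<^sub>v p" "\<And>k. k < d \<Longrightarrow> u k \<bullet> w = 0"
    and weig: "\<And>i. i \<in> I \<Longrightarrow> \<exists>a. R i *\<^sub>v w = a \<cdot>\<^sub>v w"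
    by (auto simp: W_def)
  define s where "s = 1 / sqrt (w \<bullet> w)"
  have s: "s * (s * (w \<bullet> w)) = 1"
    using real_scalar_prod_self_pos[OF w(1,2)] by (simp add: s_def flip: real_sqrt_mult)
  have wu: "w \<bullet> u k = 0" if "k < d" for k
    using w(1,3) u that by (metis comm_scalar_prod)
  have weig': "\<exists>a. R i *\<^sub>v (s \<cdot>\<^sub>v w) = a \<cdot>\<^sub>v (s \<cdot>\<^sub>v w)" if i: "i \<in> I" for i
  proof -
    obtain a where "R i *\<^sub>v w = a \<cdot>\<^sub>v w" using weig i by blast
    then have "R i *\<^sub>v (s \<cdot>\<^sub>v w) = a \<cdot>\<^sub>v (s \<cdot>\<^sub>v w)"
      using R[OF i] w(1) by (simp add: mult_mat_vec[of _ p p] smult_smult_assoc mult.commute)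
    then show ?thesis by blast
  qed
  show ?case
  proof (rule exI[of _ "u(d := s \<cdot>\<^sub>v w)"], intro conjI ballI allI impI)
    fix k assume k: "k < Suc d"
    show "(u(d := s \<cdot>\<^sub>v w)) k \<in> carrier_vec p" using k u w by auto
    show "(u(d := s \<cdot>\<^sub>v w)) k \<bullet> (u(d := s \<cdot>\<^sub>v w)) l = (if k = l then 1 else 0)"
      if l: "l < Suc d" for l
      using k l u w orth s wu by (auto simp: less_Suc_eq)
    show "\<exists>a. R i *\<^sub>v (u(d := s \<cdot>\<^sub>v w)) k = a \<cdot>\<^sub>v (u(d := s \<cdot>\<^sub>v w)) k" if "i \<in> I" for i
      using k that eig weig' by (auto simp: less_Suc_eq)
  qed
qed

lemma commuting_symmetric_orthogonally_diagonalizable: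
  fixes R :: "'i \<Rightarrow> real mat"
  assumes fin: "finite I"
    and R: "\<And>i. i \<in> I \<Longrightarrow> R i \<in> carrier_mat p p" and sym: "\<And>i. i \<in> I \<Longrightarrow> (R i)\<^sup>T = R i"
    and comm: "\<And>i j. i \<in> I \<Longrightarrow> j \<in> I \<Longrightarrow> R i * R j = R j * R i"
  shows "\<exists>U \<in> carrier_mat p p. U\<^sup>T * U = 1\<^sub>m p \<and> (\<forall>i\<in>I. diagonal_mat (mat_congr U (R i)))"
proof -
  from orthonormal_common_eigenvectors[of I R p p, OF fin R sym comm order_refl] obtain u where "(\<forall>k<p. u k \<in> carrier_vec p) \<and>
    (\<forall>k<p. \<forall>l<p. u k \<bullet> u l = (if k = l then 1 else (0::real))) \<and>
    (\<forall>i\<in>I. \<forall>k<p. \<exists>a. R i *\<^sub>v u k = a \<cdot>\<^sub>v u k)" by blast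
  then have u: "\<And>k. k < p \<Longrightarrow> u k \<in> carrier_vec p"
    and orth: "\<And>k l. k < p \<Longrightarrow> l < p \<Longrightarrow> u k \<bullet> u l = (if k = l then 1 else (0::real))"
    and eig: "\<And>i k. i \<in> I \<Longrightarrow> k < p \<Longrightarrow> \<exists>a. R i *\<^sub>v u k = a \<cdot>\<^sub>v u k"
    by blast+
  define U where "U = mat p p (\<lambda>(i, k). u k $ i)"
  have U: "U \<in> carrier_mat p p" by (simp add: U_def)
  have col: "col U k = u k" if "k < p" for k
    using that u[OF that] by (intro eq_vecI) (auto simp: U_def)
  have "U\<^sup>T * U = 1\<^sub>m p"
    using U orth by (intro eq_matI) (auto simp: col)
  moreover have "diagonal_mat (mat_congr U (R i))" if i: "i \<in> I" for i
  proof -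
    have "mat_congr U (R i) $$ (k, l) = 0" if kl: "k < p" "l < p" "k \<noteq> l" for k l
    proof -
      obtain a where a: "R i *\<^sub>v u l = a \<cdot>\<^sub>v u l" using eig i kl by blast
      have "mat_congr U (R i) = U\<^sup>T * (R i * U)"
        using U R[OF i] by (simp add: mat_congr_def assoc_mult_mat[of _ p p _ p _ p])
      then have "mat_congr U (R i) $$ (k, l) = u k \<bullet> col (R i * U) l"
        using U R[OF i] kl by (simp add: col)
      also have "col (R i * U) l = a \<cdot>\<^sub>v u l"
        by (simp only: col_mult2[OF R[OF i] U kl(2)] col[OF kl(2)] a)
      finally show ?thesis
        using orth[OF kl(1,2)] kl(3) scalar_prod_smult_distrib[OF u[OF kl(1)] u[OF kl(2)], of a] by simp
    qed
    then show ?thesis using U by (simp add: diagonal_mat_def mat_congr_def)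
  qed
  ultimately show ?thesis using U by blast
qed

section \<open>Congruence of real matrices\<close>

lemma invertible_mat_iff_det:
  fixes M :: "real mat"
  assumes M: "M \<in> carrier_mat n n"
  shows "invertible_mat M \<longleftrightarrow> det M \<noteq> 0"
proof
  assume "invertible_mat M"
  then obtain B where B: "M * B = 1\<^sub>m n" "B * M = 1\<^sub>m (dim_row B)"
    using M by (auto simp: invertible_mat_def inverts_mat_def)
  then have "dim_col (M * B) = n" "dim_col (B * M) = dim_row B" by simp_all
  then have "B \<in> carrier_mat n n" using M by auto
  then show "det M \<noteq> 0" using det_mult[OF M, of B] B(1) by auto
next
  assume "det M \<noteq> 0"
  from det_non_zero_imp_unit[OF M this, of "()"]
  obtain B where "B \<in> carrier_mat n n" "B * M = 1\<^sub>m n" "M * B = 1\<^sub>m n"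
    by (auto simp: Units_def ring_mat_def)
  then show "invertible_mat M" using M by (auto simp: invertible_mat_def inverts_mat_def)
qed

lemma invertible_matE:
  fixes M :: "real mat"
  assumes M: "M \<in> carrier_mat n n" and "invertible_mat M"
  obtains B where "B \<in> carrier_mat n n" "B * M = 1\<^sub>m n" "M * B = 1\<^sub>m n"
proof -
  have "det M \<noteq> 0" using assms invertible_mat_iff_det by blast
  from det_non_zero_imp_unit[OF M this, of "()"]
  obtain B where "B \<in> carrier_mat n n" "B * M = 1\<^sub>m n" "M * B = 1\<^sub>m n"
    by (auto simp: Units_def ring_mat_def)
  then show thesis by (rule that)
qed

lemma invertible_matI:
  fixes M :: "real mat"
  assumes M: "M \<in> carrier_mat n n" and B: "B \<in> carrier_mat n n" and BM: "B * M = 1\<^sub>m n"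
  shows "invertible_mat M"
  using mat_mult_left_right_inverse[OF B M BM] assms
  by (auto simp: invertible_mat_def inverts_mat_def)

lemma mat_congr_carrier [simp]:
  assumes "P \<in> carrier_mat n k"
  shows "mat_congr P M \<in> carrier_mat k k"
  using assms by (auto simp: mat_congr_def)

lemma mat_congr_index:
  assumes P: "P \<in> carrier_mat n k" and M: "M \<in> carrier_mat n n" and ij: "i < k" "j < k"
  shows "mat_congr P M $$ (i, j) = (\<Sum>a<n. \<Sum>b<n. P $$ (a, i) * M $$ (a, b) * P $$ (b, j))"
proof -
  have "mat_congr P M = P\<^sup>T * (M * P)"
    using P M by (simp add: mat_congr_def assoc_mult_mat[of _ k n _ n _ k])
  then show ?thesis using P M ij
    by (simp add: scalar_prod_def atLeast0LessThan sum_distrib_left mult.assoc)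
qed

lemma mat_congr_mult:
  assumes P: "P \<in> carrier_mat n k" and Q: "Q \<in> carrier_mat k l" and M: "M \<in> carrier_mat n n"
  shows "mat_congr (P * Q) M = mat_congr Q (mat_congr P M)"
proof -
  have "mat_congr (P * Q) M = Q\<^sup>T * P\<^sup>T * M * (P * Q)"
    using P Q by (simp add: mat_congr_def transpose_mult[of _ n k _ l])
  also have "\<dots> = Q\<^sup>T * P\<^sup>T * M * P * Q"
    using P Q M by (subst assoc_mult_mat[of _ l n _ k _ l]) auto
  also have "Q\<^sup>T * P\<^sup>T * M * P = Q\<^sup>T * (P\<^sup>T * M * P)"
    using P Q M by (simp add: assoc_mult_mat[of _ l k _ n _ n] assoc_mult_mat[of _ l k _ n _ k])
  finally show ?thesis by (simp add: mat_congr_def)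
qed

lemma mat_congr_symmetric:
  assumes "P \<in> carrier_mat n k" "M \<in> carrier_mat n n" "M\<^sup>T = M"
  shows "(mat_congr P M)\<^sup>T = mat_congr P M"
proof -
  have "(mat_congr P M)\<^sup>T = P\<^sup>T * (P\<^sup>T * M)\<^sup>T"
    unfolding mat_congr_def using assms by (subst transpose_mult[of _ k n _ k]) auto
  also have "(P\<^sup>T * M)\<^sup>T = M * P"
    using assms by (subst transpose_mult[of _ k n _ n]) auto
  finally show ?thesis
    using assms by (simp add: mat_congr_def assoc_mult_mat[of _ k n _ n _ k])
qed

lemma diagonal_four_block_mat_iff:
  assumes "A \<in> carrier_mat p p" "B \<in> carrier_mat p r" "C \<in> carrier_mat r p" "D \<in> carrier_mat r r"
  shows "diagonal_mat (four_block_mat A B C D) \<longleftrightarrow>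
    diagonal_mat A \<and> B = 0\<^sub>m p r \<and> C = 0\<^sub>m r p \<and> diagonal_mat D"
    (is "?L \<longleftrightarrow> ?R")
proof
  assume L: ?L
  have off: "four_block_mat A B C D $$ (i, j) = 0" if "i < p + r" "j < p + r" "i \<noteq> j" for i j
    using L that assms by (auto simp: diagonal_mat_def)
  show ?R
  proof (intro conjI)
    show "diagonal_mat A" unfolding diagonal_mat_def
    proof (intro allI impI)
      fix i j assume "i < dim_row A" "j < dim_col A" "i \<noteq> j"
      then show "A $$ (i, j) = 0" using off[of i j] assms by auto
    qed
    show "diagonal_mat D" unfolding diagonal_mat_def
    proof (intro allI impI)
      fix i j assume "i < dim_row D" "j < dim_col D" "i \<noteq> j"
      then show "D $$ (i, j) = 0" using off[of "p + i" "p + j"] assms by auto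
    qed
    show "B = 0\<^sub>m p r"
    proof (rule eq_matI)
      fix i j assume "i < dim_row (0\<^sub>m p r)" "j < dim_col (0\<^sub>m p r)"
      then show "B $$ (i, j) = 0\<^sub>m p r $$ (i, j)" using off[of i "p + j"] assms by auto
    qed (use assms in auto)
    show "C = 0\<^sub>m r p"
    proof (rule eq_matI)
      fix i j assume "i < dim_row (0\<^sub>m r p)" "j < dim_col (0\<^sub>m r p)"
      then show "C $$ (i, j) = 0\<^sub>m r p $$ (i, j)" using off[of "p + i" j] assms by auto
    qed (use assms in auto)
  qed
next
  assume ?R
  then show ?L using assms by (auto simp: diagonal_mat_def)
qed

section \<open>Congruences that diagonalize a partial identity\<close>

abbreviation (input) partial_identity :: "nat \<Rightarrow> nat \<Rightarrow> real mat" where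
  "partial_identity p r \<equiv> four_block_mat (1\<^sub>m p) (0\<^sub>m p r) (0\<^sub>m r p) (0\<^sub>m r r)"

lemma mat_congr_partial_identity_index:
  assumes P: "P \<in> carrier_mat (p + r) k" and ij: "i < k" "j < k"
  shows "mat_congr P (partial_identity p r) $$ (i, j) = (\<Sum>a<p. P $$ (a, i) * P $$ (a, j))"
proof -
  have "mat_congr P (partial_identity p r) $$ (i, j) =
      (\<Sum>a<p + r. \<Sum>b<p + r. P $$ (a, i) * partial_identity p r $$ (a, b) * P $$ (b, j))"
    using P ij by (intro mat_congr_index) auto
  also have "\<dots> = (\<Sum>a<p + r. \<Sum>b<p + r. if b = a then (if a < p then P $$ (a, i) * P $$ (a, j) else 0) else 0)"
    by (intro sum.cong refl) auto
  also have "\<dots> = (\<Sum>a<p + r. if a < p then P $$ (a, i) * P $$ (a, j) else 0)"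
    by (intro sum.cong refl) (simp add: sum.delta)
  also have "\<dots> = (\<Sum>a<p. P $$ (a, i) * P $$ (a, j))"
    by (intro sum.mono_neutral_cong_right) auto
  finally show ?thesis .
qed

text \<open>
This is block elimination in which \<open>W\<close> need not solve \<open>N = W K\<close>: the failure \<open>N - W K\<close> stays visible
as the off-diagonal block.
\<close>

lemma mat_congr_shear:
  assumes M1: "M1 \<in> carrier_mat p p" and N: "N \<in> carrier_mat p r" and K: "K \<in> carrier_mat r r"
    and W: "W \<in> carrier_mat p r" and sym: "K\<^sup>T = K"
  shows "mat_congr (four_block_mat (1\<^sub>m p) (0\<^sub>m p r) (- W\<^sup>T) (1\<^sub>m r)) (four_block_mat M1 N N\<^sup>T K) =
    four_block_mat (M1 - W * N\<^sup>T - (N - W * K) * W\<^sup>T) (N - W * K) ((N - W * K)\<^sup>T) K"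
    (is "mat_congr ?L ?M = _")
proof -
  have LT: "?L\<^sup>T = four_block_mat (1\<^sub>m p) (- W) (0\<^sub>m r p) (1\<^sub>m r)"
    using W by (subst transpose_four_block_mat[of _ p p _ r _ r]) (auto simp: transpose_uminus)
  have "?L\<^sup>T * ?M = four_block_mat (1\<^sub>m p * M1 + - W * N\<^sup>T) (1\<^sub>m p * N + - W * K)
      (0\<^sub>m r p * M1 + 1\<^sub>m r * N\<^sup>T) (0\<^sub>m r p * N + 1\<^sub>m r * K)"
    unfolding LT using assms by (intro mult_four_block_mat) auto
  also have "\<dots> = four_block_mat (M1 - W * N\<^sup>T) (N - W * K) N\<^sup>T K"
    using assms by (simp add: minus_add_uminus_mat[of _ p p] minus_add_uminus_mat[of _ p r])
  finally have LM: "?L\<^sup>T * ?M = \<dots>" .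
  have "?L\<^sup>T * ?M * ?L = four_block_mat ((M1 - W * N\<^sup>T) * 1\<^sub>m p + (N - W * K) * - W\<^sup>T)
      ((M1 - W * N\<^sup>T) * 0\<^sub>m p r + (N - W * K) * 1\<^sub>m r)
      (N\<^sup>T * 1\<^sub>m p + K * - W\<^sup>T) (N\<^sup>T * 0\<^sub>m p r + K * 1\<^sub>m r)"
    unfolding LM using assms by (intro mult_four_block_mat) auto
  also have "\<dots> = four_block_mat (M1 - W * N\<^sup>T - (N - W * K) * W\<^sup>T) (N - W * K) ((N - W * K)\<^sup>T) K"
  proof -
    have "(M1 - W * N\<^sup>T) * 1\<^sub>m p + (N - W * K) * - W\<^sup>T = M1 - W * N\<^sup>T - (N - W * K) * W\<^sup>T"
      using assms by (intro eq_matI) auto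
    moreover have "N\<^sup>T * 1\<^sub>m p + K * - W\<^sup>T = (N - W * K)\<^sup>T"
      using assms by (simp add: transpose_minus[of _ p r] transpose_mult[of _ p r _ r] minus_add_uminus_mat[of _ r p])
    moreover have "(M1 - W * N\<^sup>T) * 0\<^sub>m p r + (N - W * K) * 1\<^sub>m r = N - W * K"
      using assms by (subst right_mult_zero_mat[of _ p p]) auto
    moreover have "N\<^sup>T * 0\<^sub>m p r + K * 1\<^sub>m r = K"
      using assms by (subst right_mult_zero_mat[of _ r p]) auto
    ultimately show ?thesis by (simp only:)
  qed
  finally show ?thesis unfolding mat_congr_def .
qed

lemma mat_congr_block_diag:
  assumes M1: "M1 \<in> carrier_mat p p" and N: "N \<in> carrier_mat p r" and K: "K \<in> carrier_mat r r"
    and U: "U \<in> carrier_mat p p" and V: "V \<in> carrier_mat r r" and N': "N' \<in> carrier_mat r p"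
  shows "mat_congr (four_block_mat U (0\<^sub>m p r) (0\<^sub>m r p) V) (four_block_mat M1 N N' K) =
    four_block_mat (mat_congr U M1) (U\<^sup>T * N * V) (V\<^sup>T * N' * U) (mat_congr V K)"
    (is "mat_congr ?L ?M = _")
proof -
  have LT: "?L\<^sup>T = four_block_mat U\<^sup>T (0\<^sub>m p r) (0\<^sub>m r p) V\<^sup>T"
    using U V by (subst transpose_four_block_mat[of _ p p _ r _ r]) auto
  have "?L\<^sup>T * ?M = four_block_mat (U\<^sup>T * M1 + 0\<^sub>m p r * N') (U\<^sup>T * N + 0\<^sub>m p r * K)
      (0\<^sub>m r p * M1 + V\<^sup>T * N') (0\<^sub>m r p * N + V\<^sup>T * K)"
    unfolding LT using assms by (intro mult_four_block_mat) auto
  also have "\<dots> = four_block_mat (U\<^sup>T * M1) (U\<^sup>T * N) (V\<^sup>T * N') (V\<^sup>T * K)"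
    using assms by simp
  finally have LM: "?L\<^sup>T * ?M = \<dots>" .
  have "?L\<^sup>T * ?M * ?L = four_block_mat (U\<^sup>T * M1 * U + U\<^sup>T * N * 0\<^sub>m r p)
      (U\<^sup>T * M1 * 0\<^sub>m p r + U\<^sup>T * N * V) (V\<^sup>T * N' * U + V\<^sup>T * K * 0\<^sub>m r p) (V\<^sup>T * N' * 0\<^sub>m p r + V\<^sup>T * K * V)"
    unfolding LM using assms by (intro mult_four_block_mat) auto
  also have "\<dots> = four_block_mat (mat_congr U M1) (U\<^sup>T * N * V) (V\<^sup>T * N' * U) (mat_congr V K)"
  proof -
    have z: "U\<^sup>T * N * 0\<^sub>m r p = 0\<^sub>m p p" "U\<^sup>T * M1 * 0\<^sub>m p r = 0\<^sub>m p r"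
      "V\<^sup>T * K * 0\<^sub>m r p = 0\<^sub>m r p" "V\<^sup>T * N' * 0\<^sub>m p r = 0\<^sub>m r r"
      using assms by (auto intro!: right_mult_zero_mat)
    have "U\<^sup>T * M1 * U \<in> carrier_mat p p" "U\<^sup>T * N * V \<in> carrier_mat p r"
      "V\<^sup>T * N' * U \<in> carrier_mat r p" "V\<^sup>T * K * V \<in> carrier_mat r r"
      using assms by auto
    then show ?thesis unfolding z mat_congr_def by simp
  qed
  finally show ?thesis unfolding mat_congr_def .
qed

text \<open>
With \<open>d\<close> the diagonal of \<open>P\<^sup>T J P\<close>, the upper parts of the columns with \<open>d j \<noteq> 0\<close> are orthogonal and
nonzero in dimension \<open>p\<close>, so there are at most \<open>p\<close> of them. The columns with \<open>d j = 0\<close> have zero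
upper part, so their lower parts are independent in dimension \<open>r\<close> and there are at most \<open>r\<close> of them.
As \<open>P\<close> has \<open>p + r\<close> columns, both bounds are attained.
\<close>

lemma partial_identity_congruence_support:
  assumes P: "P \<in> carrier_mat (p + r) (p + r)" and Q: "Q \<in> carrier_mat (p + r) (p + r)"
    and QP: "Q * P = 1\<^sub>m (p + r)"
    and diag: "diagonal_mat (mat_congr P (partial_identity p r))"
  defines "d \<equiv> \<lambda>j. \<Sum>a<p. P $$ (a, j) * P $$ (a, j)"
  shows "card {j. j < p + r \<and> d j \<noteq> 0} = p"
proof -
  define S where "S = {j. j < p + r \<and> d j \<noteq> 0}"
  define T where "T = {j. j < p + r \<and> d j = 0}"
  have fin: "finite S" "finite T" by (auto simp: S_def T_def)
  have "card S + card T = card (S \<union> T)" using fin by (subst card_Un_disjoint) (auto simp: S_def T_def)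
  also have "S \<union> T = {..<p + r}" by (auto simp: S_def T_def)
  finally have sum: "card S + card T = p + r" by simp
  obtain f where f: "bij_betw f {..<card S} S"
    using fin(1) by (metis atLeast0LessThan ex_bij_betw_nat_finite)
  have fS: "f i < p + r" "d (f i) \<noteq> 0" if "i < card S" for i
    using bij_betwE[OF f] that by (auto simp: S_def)
  obtain g where g: "bij_betw g {..<card T} T"
    using fin(2) by (metis atLeast0LessThan ex_bij_betw_nat_finite)
  have gT: "g i < p + r" "d (g i) = 0" if "i < card T" for i
    using bij_betwE[OF g] that by (auto simp: T_def)
  have orth: "(\<Sum>a<p. P $$ (a, i) * P $$ (a, j)) = 0" if "i < p + r" "j < p + r" "i \<noteq> j" for i j
    using diag that mat_congr_partial_identity_index[OF P, of i j] P
    by (auto simp: diagonal_mat_def mat_congr_def)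
  have "card S \<le> p"
  proof (rule left_invertible_rows_le_cols)
    show "mat (card S) p (\<lambda>(i, a). P $$ (a, f i) / d (f i)) \<in> carrier_mat (card S) p"
      "mat p (card S) (\<lambda>(a, j). P $$ (a, f j)) \<in> carrier_mat p (card S)" by auto
    show "mat (card S) p (\<lambda>(i, a). P $$ (a, f i) / d (f i)) * mat p (card S) (\<lambda>(a, j). P $$ (a, f j)) =
      1\<^sub>m (card S)" (is "?X * ?Y = _")
    proof (rule eq_matI)
      fix i j assume "i < dim_row (1\<^sub>m (card S))" "j < dim_col (1\<^sub>m (card S))"
      then have ij: "i < card S" "j < card S" by auto
      have "(?X * ?Y) $$ (i, j) = (\<Sum>a<p. P $$ (a, f i) * P $$ (a, f j)) / d (f i)"
        using ij by (simp add: scalar_prod_def atLeast0LessThan sum_divide_distrib)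
      also have "\<dots> = (if i = j then 1 else 0)"
      proof (cases "i = j")
        case True
        then show ?thesis using fS[OF ij(1)] by (simp add: d_def)
      next
        case False
        then have "f i \<noteq> f j" using f ij by (auto simp: bij_betw_def inj_on_def)
        then show ?thesis using False orth fS ij by simp
      qed
      finally show "(?X * ?Y) $$ (i, j) = 1\<^sub>m (card S) $$ (i, j)" using ij by simp
    qed auto
  qed
  moreover have "card T \<le> r"
  proof (rule left_invertible_rows_le_cols)
    show "mat (card T) r (\<lambda>(i, b). Q $$ (g i, p + b)) \<in> carrier_mat (card T) r"
      "mat r (card T) (\<lambda>(b, j). P $$ (p + b, g j)) \<in> carrier_mat r (card T)" by auto
    show "mat (card T) r (\<lambda>(i, b). Q $$ (g i, p + b)) * mat r (card T) (\<lambda>(b, j). P $$ (p + b, g j)) =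
      1\<^sub>m (card T)" (is "?X * ?Y = _")
    proof (rule eq_matI)
      fix i j assume "i < dim_row (1\<^sub>m (card T))" "j < dim_col (1\<^sub>m (card T))"
      then have ij: "i < card T" "j < card T" by auto
      have zero: "P $$ (a, g j) = 0" if "a < p" for a
        using gT(2)[OF ij(2)] that by (simp add: d_def sum_nonneg_eq_0_iff)
      have "(?X * ?Y) $$ (i, j) = (\<Sum>b<r. Q $$ (g i, p + b) * P $$ (p + b, g j))"
        using ij by (simp add: scalar_prod_def atLeast0LessThan)
      also have "\<dots> = (\<Sum>c\<in>{p..<p + r}. Q $$ (g i, c) * P $$ (c, g j))"
        by (rule sum.reindex_bij_witness[of _ "\<lambda>c. c - p" "\<lambda>b. p + b"]) auto
      also have "\<dots> = (\<Sum>c<p + r. Q $$ (g i, c) * P $$ (c, g j))"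
        using zero by (intro sum.mono_neutral_left) auto
      also have "\<dots> = (Q * P) $$ (g i, g j)"
        using P Q gT ij by (simp add: scalar_prod_def atLeast0LessThan)
      also have "\<dots> = (if g i = g j then 1 else 0)" using gT ij by (simp add: QP)
      also have "\<dots> = (if i = j then 1 else 0)"
        using g ij by (auto simp: bij_betw_def inj_on_def)
      finally show "(?X * ?Y) $$ (i, j) = 1\<^sub>m (card T) $$ (i, j)" using ij by simp
    qed auto
  qed
  ultimately show ?thesis using sum unfolding S_def by linarith
qed

text \<open>
Moving the \<open>p\<close> columns with nonzero upper part to the front and normalizing these upper parts makes
them the columns of an orthogonal matrix. Permuting and rescaling columns keeps every diagonal
congruent matrix diagonal, hence the last conclusion for all \<open>M\<close> at once.
\<close>

lemma partial_identity_congruence_block_form: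
  assumes P: "P \<in> carrier_mat (p + r) (p + r)" and inv: "invertible_mat P"
    and diag: "diagonal_mat (mat_congr P (partial_identity p r))"
  obtains U C V where "U \<in> carrier_mat p p" "U\<^sup>T * U = 1\<^sub>m p" "C \<in> carrier_mat r p"
    "V \<in> carrier_mat r r" "invertible_mat V"
    "\<And>M. M \<in> carrier_mat (p + r) (p + r) \<Longrightarrow> diagonal_mat (mat_congr P M) \<Longrightarrow>
      diagonal_mat (mat_congr (four_block_mat U (0\<^sub>m p r) C V) M)"
proof -
  let ?n = "p + r"
  obtain Q where Q: "Q \<in> carrier_mat ?n ?n" and QP: "Q * P = 1\<^sub>m ?n"
    by (rule invertible_matE[OF P inv])
  define d where "d = (\<lambda>j. \<Sum>a<p. P $$ (a, j) * P $$ (a, j))"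
  define S where "S = {j. j < ?n \<and> d j \<noteq> 0}"
  have card: "card S = p"
    using partial_identity_congruence_support[OF P Q QP diag] by (simp add: S_def d_def)
  have "S \<subseteq> {..<?n}" by (auto simp: S_def)
  then have "card ({..<?n} - S) = r"
    using card by (subst card_Diff_subset) (auto intro: finite_subset)
  then obtain g where g: "bij_betw g {p..<p + r} ({..<?n} - S)"
    using finite_same_card_bij[of "{p..<p + r}" "{..<?n} - S"] by auto
  \<comment> \<open>\<open>\<sigma>\<close> lists the columns with nonzero upper part first; \<open>c\<close> scales these parts to length 1.\<close>
  obtain f where f: "bij_betw f {..<p} S"
    using finite_same_card_bij[of "{..<p}" S] card by (auto simp: S_def)
  define \<sigma> where "\<sigma> k = (if k < p then f k else g k)" for k
  have "bij_betw \<sigma> {..<p} S"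
    using f by (rule bij_betw_cong[THEN iffD1, rotated]) (simp add: \<sigma>_def)
  moreover have "bij_betw \<sigma> {p..<p + r} ({..<?n} - S)"
    using g by (rule bij_betw_cong[THEN iffD1, rotated]) (simp add: \<sigma>_def)
  ultimately have "bij_betw \<sigma> ({..<p} \<union> {p..<p + r}) (S \<union> ({..<?n} - S))"
    by (rule bij_betw_combine) auto
  moreover have "{..<p} \<union> {p..<p + r} = {..<?n}" "S \<union> ({..<?n} - S) = {..<?n}"
    using \<open>S \<subseteq> {..<?n}\<close> by auto
  ultimately have \<sigma>: "bij_betw \<sigma> {..<?n} {..<?n}" by simp
  have \<sigma>n: "\<sigma> k < ?n" if "k < ?n" for k using bij_betwE[OF \<sigma>] that by auto
  have \<sigma>_eq: "\<sigma> k = \<sigma> l \<longleftrightarrow> k = l" if "k < ?n" "l < ?n" for k l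
    using \<sigma> that by (auto simp: bij_betw_def inj_on_def)
  have \<sigma>S: "d (\<sigma> k) \<noteq> 0" if "k < p" for k
    using bij_betwE[OF \<open>bij_betw \<sigma> {..<p} S\<close>] that by (auto simp: S_def)
  have \<sigma>T: "d (\<sigma> k) = 0" if "p \<le> k" "k < ?n" for k
    using bij_betwE[OF \<open>bij_betw \<sigma> {p..<p + r} ({..<?n} - S)\<close>] that by (auto simp: S_def)
  have dpos: "d j \<ge> 0" for j by (simp add: d_def sum_nonneg)
  define c where "c k = (if k < p then 1 / sqrt (d (\<sigma> k)) else 1)" for k
  have c0: "c k \<noteq> 0" if "k < ?n" for k using \<sigma>S that by (auto simp: c_def)
  define P' where "P' = mat ?n ?n (\<lambda>(i, k). P $$ (i, \<sigma> k) * c k)"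
  have P': "P' \<in> carrier_mat ?n ?n" by (simp add: P'_def)
  have congr': "mat_congr P' M $$ (k, l) = c k * c l * mat_congr P M $$ (\<sigma> k, \<sigma> l)"
    if M: "M \<in> carrier_mat ?n ?n" and kl: "k < ?n" "l < ?n" for M k l
    using mat_congr_index[OF P M \<sigma>n[OF kl(1)] \<sigma>n[OF kl(2)]] mat_congr_index[OF P' M kl] kl
    by (simp add: P'_def sum_distrib_left mult_ac)
  have diag': "diagonal_mat (mat_congr P' M)"
    if M: "M \<in> carrier_mat ?n ?n" and "diagonal_mat (mat_congr P M)" for M
    using that P P' \<sigma>_eq \<sigma>n congr'[OF M] by (auto simp: diagonal_mat_def mat_congr_def)
  define U where "U = mat p p (\<lambda>(i, k). P' $$ (i, k))"
  define C where "C = mat r p (\<lambda>(i, k). P' $$ (p + i, k))"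
  define V where "V = mat r r (\<lambda>(i, k). P' $$ (p + i, p + k))"
  have U: "U \<in> carrier_mat p p" and C: "C \<in> carrier_mat r p" and V: "V \<in> carrier_mat r r"
    by (auto simp: U_def C_def V_def)
  have zero: "P' $$ (i, p + k) = 0" if "i < p" "k < r" for i k
  proof -
    have "d (\<sigma> (p + k)) = 0" using \<sigma>T that by simp
    then have "P $$ (i, \<sigma> (p + k)) = 0" using that by (simp add: d_def sum_nonneg_eq_0_iff)
    then show ?thesis using that by (simp add: P'_def)
  qed
  have block: "P' = four_block_mat U (0\<^sub>m p r) C V"
  proof (rule eq_matI)
    fix i k assume "i < dim_row (four_block_mat U (0\<^sub>m p r) C V)" "k < dim_col (four_block_mat U (0\<^sub>m p r) C V)"
    then have ik: "i < ?n" "k < ?n" using U V by auto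
    show "P' $$ (i, k) = four_block_mat U (0\<^sub>m p r) C V $$ (i, k)"
      using ik zero[of i "k - p"] U V C by (auto simp: U_def C_def V_def)
  qed (use U V P' in auto)
  have UU: "U\<^sup>T * U = 1\<^sub>m p"
  proof (rule eq_matI)
    fix k l assume "k < dim_row (1\<^sub>m p)" "l < dim_col (1\<^sub>m p)"
    then have kl: "k < p" "l < p" by auto
    have "(U\<^sup>T * U) $$ (k, l) = c k * c l * (\<Sum>a<p. P $$ (a, \<sigma> k) * P $$ (a, \<sigma> l))"
      using kl by (simp add: U_def P'_def scalar_prod_def atLeast0LessThan sum_distrib_left mult_ac)
    also have "\<dots> = (if k = l then 1 else 0)"
    proof (cases "k = l")
      case True
      have "c l * c l * d (\<sigma> l) = 1" using kl \<sigma>S[of l] dpos[of "\<sigma> l"]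
        by (simp add: c_def flip: real_sqrt_mult)
      then show ?thesis using True by (simp add: d_def)
    next
      case False
      then have "mat_congr P (partial_identity p r) $$ (\<sigma> k, \<sigma> l) = 0"
        using diag P kl \<sigma>n \<sigma>_eq by (auto simp: diagonal_mat_def mat_congr_def)
      then show ?thesis
        using False kl \<sigma>n mat_congr_partial_identity_index[OF P, of "\<sigma> k" "\<sigma> l"] by simp
    qed
    finally show "(U\<^sup>T * U) $$ (k, l) = 1\<^sub>m p $$ (k, l)" using kl by simp
  qed (use U in auto)
  have "mat ?n ?n (\<lambda>(k, i). Q $$ (\<sigma> k, i) / c k) * P' = 1\<^sub>m ?n" (is "?Q' * _ = _")
  proof (rule eq_matI)
    fix k l assume "k < dim_row (1\<^sub>m ?n)" "l < dim_col (1\<^sub>m ?n)"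
    then have kl: "k < ?n" "l < ?n" by auto
    have "(?Q' * P') $$ (k, l) = c l / c k * (\<Sum>i<?n. Q $$ (\<sigma> k, i) * P $$ (i, \<sigma> l))"
      using kl by (simp add: P'_def scalar_prod_def atLeast0LessThan sum_distrib_left mult_ac)
    also have "(\<Sum>i<?n. Q $$ (\<sigma> k, i) * P $$ (i, \<sigma> l)) = (Q * P) $$ (\<sigma> k, \<sigma> l)"
      using P Q \<sigma>n kl by (simp add: scalar_prod_def atLeast0LessThan)
    finally show "(?Q' * P') $$ (k, l) = 1\<^sub>m ?n $$ (k, l)"
      using kl \<sigma>n \<sigma>_eq c0 by (simp add: QP)
  qed (use P' in auto)
  then have "invertible_mat P'" using P' by (intro invertible_matI[of _ ?n ?Q']) auto
  then have "det P' \<noteq> 0" using invertible_mat_iff_det[OF P'] by blast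
  then have "det V \<noteq> 0"
    unfolding block using det_four_block_mat_upper_right_zero[OF U refl C V] by auto
  then have "invertible_mat V" using invertible_mat_iff_det[OF V] by blast
  then show thesis by (rule that[OF U UU C V _ diag'[unfolded block]])
qed

text \<open>
In block form \<open>P = ((U, 0), (C, V))\<close>, the choice \<open>W = - U C\<^sup>T\<close> is the one for which \<open>P\<close> is the shear
by \<open>W\<close> followed by \<open>diag(U, V)\<close>. The off-diagonal block of the result is \<open>U\<^sup>T (N - W K) V\<close>, and it can
vanish only if \<open>N = W K\<close>.
\<close>

lemma simultaneous_block_diagonalization_necessary:
  assumes M1: "\<And>i. i \<in> I \<Longrightarrow> M1 i \<in> carrier_mat p p" and N: "\<And>i. i \<in> I \<Longrightarrow> N i \<in> carrier_mat p r"
    and K: "\<And>i. i \<in> I \<Longrightarrow> K i \<in> carrier_mat r r" and symK: "\<And>i. i \<in> I \<Longrightarrow> (K i)\<^sup>T = K i"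
    and P: "P \<in> carrier_mat (p + r) (p + r)" "invertible_mat P"
    and diagJ: "diagonal_mat (mat_congr P (partial_identity p r))"
    and diagM: "\<And>i. i \<in> I \<Longrightarrow> diagonal_mat (mat_congr P (four_block_mat (M1 i) (N i) (N i)\<^sup>T (K i)))"
  obtains U V W where "U \<in> carrier_mat p p" "U\<^sup>T * U = 1\<^sub>m p" "V \<in> carrier_mat r r" "invertible_mat V"
    "W \<in> carrier_mat p r"
    "\<And>i. i \<in> I \<Longrightarrow> N i = W * K i" "\<And>i. i \<in> I \<Longrightarrow> diagonal_mat (mat_congr V (K i))"
    "\<And>i. i \<in> I \<Longrightarrow> diagonal_mat (mat_congr U (M1 i - W * (N i)\<^sup>T))"
proof -
  obtain U C V where U: "U \<in> carrier_mat p p" "U\<^sup>T * U = 1\<^sub>m p" and C: "C \<in> carrier_mat r p"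
    and V: "V \<in> carrier_mat r r" "invertible_mat V"
    and diag: "\<And>M. M \<in> carrier_mat (p + r) (p + r) \<Longrightarrow> diagonal_mat (mat_congr P M) \<Longrightarrow>
      diagonal_mat (mat_congr (four_block_mat U (0\<^sub>m p r) C V) M)"
    using P diagJ by (rule partial_identity_congruence_block_form) blast
  have UU: "U * U\<^sup>T = 1\<^sub>m p" using mat_mult_left_right_inverse[of "U\<^sup>T" p U] U by simp
  obtain V' where V': "V' \<in> carrier_mat r r" "V * V' = 1\<^sub>m r" by (rule invertible_matE[OF V])
  define W where "W = - (U * C\<^sup>T)"
  have W: "W \<in> carrier_mat p r" using U C by (simp add: W_def)
  let ?L = "four_block_mat (1\<^sub>m p) (0\<^sub>m p r) (- W\<^sup>T) (1\<^sub>m r)"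
  let ?D = "four_block_mat U (0\<^sub>m p r) (0\<^sub>m r p) V"
  have WT: "- W\<^sup>T = C * U\<^sup>T" using U C
    by (simp add: W_def transpose_uminus transpose_mult[of _ p p _ r])
  have CU: "- W\<^sup>T * U = C" unfolding WT using U C by (simp add: assoc_mult_mat[of _ r p _ p _ p])
  have "?L * ?D = four_block_mat (1\<^sub>m p * U + 0\<^sub>m p r * 0\<^sub>m r p) (1\<^sub>m p * 0\<^sub>m p r + 0\<^sub>m p r * V)
      (- W\<^sup>T * U + 1\<^sub>m r * 0\<^sub>m r p) (- W\<^sup>T * 0\<^sub>m p r + 1\<^sub>m r * V)"
    using U V W by (intro mult_four_block_mat) auto
  also have "\<dots> = four_block_mat U (0\<^sub>m p r) C V"
    unfolding CU using U V W C by simp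
  finally have LD: "four_block_mat U (0\<^sub>m p r) C V = ?L * ?D" by simp
  have key: "N i = W * K i \<and> diagonal_mat (mat_congr V (K i)) \<and>
      diagonal_mat (mat_congr U (M1 i - W * (N i)\<^sup>T))" if i: "i \<in> I" for i
  proof -
    note Mi = M1[OF i] and Ni = N[OF i] and Ki = K[OF i]
    let ?E = "N i - W * K i"
    have E: "?E \<in> carrier_mat p r" using W Ki by (intro minus_carrier_mat mult_carrier_mat)
    have M: "four_block_mat (M1 i) (N i) (N i)\<^sup>T (K i) \<in> carrier_mat (p + r) (p + r)"
      using Mi Ki by simp
    have "mat_congr (?L * ?D) (four_block_mat (M1 i) (N i) (N i)\<^sup>T (K i)) =
        mat_congr ?D (mat_congr ?L (four_block_mat (M1 i) (N i) (N i)\<^sup>T (K i)))"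
      using U V M by (intro mat_congr_mult[of _ "p + r" "p + r" _ "p + r"]) auto
    also have "\<dots> = four_block_mat (mat_congr U (M1 i - W * (N i)\<^sup>T - ?E * W\<^sup>T)) (U\<^sup>T * ?E * V)
        (V\<^sup>T * ?E\<^sup>T * U) (mat_congr V (K i))"
      unfolding mat_congr_shear[OF Mi Ni Ki W symK[OF i]]
      using U V Mi Ni Ki W by (intro mat_congr_block_diag) auto
    finally have "diagonal_mat \<dots>" using diag[OF M diagM[OF i]] by (simp add: LD)
    then have *: "diagonal_mat (mat_congr U (M1 i - W * (N i)\<^sup>T - ?E * W\<^sup>T))" "U\<^sup>T * ?E * V = 0\<^sub>m p r"
        "diagonal_mat (mat_congr V (K i))"
      using U V E by (subst (asm) diagonal_four_block_mat_iff[of _ p _ r]; simp)+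
    have "X = U * (U\<^sup>T * X * V) * V'" if X: "X \<in> carrier_mat p r" for X
    proof -
      have "U * (U\<^sup>T * X * V) * V' = (U * U\<^sup>T) * X * (V * V')"
        using U V V' X by (simp add: assoc_mult_mat[of _ p p _ p _ r] assoc_mult_mat[of _ p r _ r _ r] assoc_mult_mat[of _ p p _ r _ r])
      then show ?thesis unfolding UU V'(2) using X by simp
    qed
    from this[OF E] have "?E = U * (U\<^sup>T * ?E * V) * V'" .
    also have "\<dots> = 0\<^sub>m p r" unfolding *(2) using U V' by simp
    finally have E0: "?E = 0\<^sub>m p r" .
    have "N i = W * K i"
    proof (rule eq_matI)
      fix a b assume "a < dim_row (W * K i)" "b < dim_col (W * K i)"
      then show "N i $$ (a, b) = (W * K i) $$ (a, b)"
        using arg_cong[OF E0, of "\<lambda>X. X $$ (a, b)"] W Ki Ni by simp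
    qed (use W Ki Ni in auto)
    moreover have "M1 i - W * (N i)\<^sup>T - ?E * W\<^sup>T = M1 i - W * (N i)\<^sup>T"
      unfolding E0 using W Mi Ni by (intro eq_matI) auto
    ultimately show ?thesis using * by simp
  qed
  show thesis by (rule that[OF U V W]) (use key in blast)+
qed

text \<open>
The same product of a shear and a block diagonal matrix serves as the diagonalizing congruence.
\<close>

lemma simultaneous_block_diagonalization_sufficient:
  assumes M1: "\<And>i. i \<in> I \<Longrightarrow> M1 i \<in> carrier_mat p p" and N: "\<And>i. i \<in> I \<Longrightarrow> N i \<in> carrier_mat p r"
    and K: "\<And>i. i \<in> I \<Longrightarrow> K i \<in> carrier_mat r r" and symK: "\<And>i. i \<in> I \<Longrightarrow> (K i)\<^sup>T = K i"
    and U: "U \<in> carrier_mat p p" "U\<^sup>T * U = 1\<^sub>m p" and V: "V \<in> carrier_mat r r" "invertible_mat V"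
    and W: "W \<in> carrier_mat p r"
    and NW: "\<And>i. i \<in> I \<Longrightarrow> N i = W * K i" and diagK: "\<And>i. i \<in> I \<Longrightarrow> diagonal_mat (mat_congr V (K i))"
    and diagM: "\<And>i. i \<in> I \<Longrightarrow> diagonal_mat (mat_congr U (M1 i - W * (N i)\<^sup>T))"
  obtains P where "P \<in> carrier_mat (p + r) (p + r)" "invertible_mat P"
    "diagonal_mat (mat_congr P (partial_identity p r))"
    "\<And>i. i \<in> I \<Longrightarrow> diagonal_mat (mat_congr P (four_block_mat (M1 i) (N i) (N i)\<^sup>T (K i)))"
proof -
  let ?L = "four_block_mat (1\<^sub>m p) (0\<^sub>m p r) (- W\<^sup>T) (1\<^sub>m r)"
  let ?D = "four_block_mat U (0\<^sub>m p r) (0\<^sub>m r p) V"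
  have L: "?L \<in> carrier_mat (p + r) (p + r)" and D: "?D \<in> carrier_mat (p + r) (p + r)"
    using U V by auto
  have shear: "mat_congr (?L * ?D) (four_block_mat X Y Y\<^sup>T Z) =
      four_block_mat (mat_congr U (X - W * Y\<^sup>T)) (0\<^sub>m p r) (0\<^sub>m r p) (mat_congr V Z)"
    if X: "X \<in> carrier_mat p p" and Y: "Y \<in> carrier_mat p r" and Z: "Z \<in> carrier_mat r r" "Z\<^sup>T = Z"
      and YWZ: "Y = W * Z" for X Y Z
  proof -
    have E: "Y - W * Z = 0\<^sub>m p r" unfolding YWZ using W Z by (intro eq_matI) auto
    have "mat_congr (?L * ?D) (four_block_mat X Y Y\<^sup>T Z) = mat_congr ?D (mat_congr ?L (four_block_mat X Y Y\<^sup>T Z))"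
      using U V X Z by (intro mat_congr_mult[of _ "p + r" "p + r" _ "p + r"]) auto
    also have "mat_congr ?L (four_block_mat X Y Y\<^sup>T Z) =
        four_block_mat (X - W * Y\<^sup>T) (0\<^sub>m p r) (0\<^sub>m r p) Z"
    proof -
      have "X - W * Y\<^sup>T - 0\<^sub>m p r * W\<^sup>T = X - W * Y\<^sup>T"
        using W X Y by (intro eq_matI) auto
      then show ?thesis unfolding mat_congr_shear[OF X Y Z(1) W Z(2)] E by simp
    qed
    also have "mat_congr ?D \<dots> =
        four_block_mat (mat_congr U (X - W * Y\<^sup>T)) (U\<^sup>T * 0\<^sub>m p r * V) (V\<^sup>T * 0\<^sub>m r p * U) (mat_congr V Z)"
      using U V X Y W Z by (intro mat_congr_block_diag) auto
    finally show ?thesis using U V by simp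
  qed
  have "det ?L = 1"
    using W by (subst det_four_block_mat_upper_right_zero[of _ p _ r]) auto
  moreover have "det ?D = det U * det V"
    using U V by (subst det_four_block_mat_upper_right_zero[of _ p _ r]) auto
  moreover have "det U \<noteq> 0" using invertible_matI[of U p "U\<^sup>T"] U invertible_mat_iff_det[of U p] by simp
  moreover have "det V \<noteq> 0" using V invertible_mat_iff_det by blast
  ultimately have "det (?L * ?D) \<noteq> 0" using det_mult[OF L D] by simp
  then have "invertible_mat (?L * ?D)" using invertible_mat_iff_det[of "?L * ?D" "p + r"] L D by simp
  moreover have "diagonal_mat (mat_congr (?L * ?D) (partial_identity p r))"
  proof -
    have "mat_congr (?L * ?D) (four_block_mat (1\<^sub>m p) (0\<^sub>m p r) (0\<^sub>m p r)\<^sup>T (0\<^sub>m r r)) =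
        four_block_mat (mat_congr U (1\<^sub>m p - W * (0\<^sub>m p r)\<^sup>T)) (0\<^sub>m p r) (0\<^sub>m r p) (mat_congr V (0\<^sub>m r r))"
      using W by (intro shear) auto
    moreover have "1\<^sub>m p - W * (0\<^sub>m p r)\<^sup>T = 1\<^sub>m p"
      using W by (intro eq_matI) auto
    moreover have "mat_congr U (1\<^sub>m p) = 1\<^sub>m p" using U by (simp add: mat_congr_def)
    moreover have "mat_congr V (0\<^sub>m r r) = 0\<^sub>m r r" using V by (simp add: mat_congr_def)
    ultimately have "mat_congr (?L * ?D) (partial_identity p r) = partial_identity p r" by simp
    then show ?thesis
      by (simp only:) (subst diagonal_four_block_mat_iff[of _ p _ r]; simp add: diagonal_mat_def)
  qed
  moreover have "diagonal_mat (mat_congr (?L * ?D) (four_block_mat (M1 i) (N i) (N i)\<^sup>T (K i)))" if i: "i \<in> I" for i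
    unfolding shear[OF M1[OF i] N[OF i] K[OF i] symK[OF i] NW[OF i]]
    using U V M1[OF i] N[OF i] K[OF i] W diagK[OF i] diagM[OF i]
    by (subst diagonal_four_block_mat_iff[of _ p _ r]) auto
  ultimately show thesis using mult_carrier_mat[OF L D] by (intro that[of "?L * ?D"]) auto
qed

section \<open>Elimination with diagonal lower right blocks\<close>

lemma mult_diagonal_mat_right_index:
  fixes X D :: "real mat"
  assumes "X \<in> carrier_mat p q" "D \<in> carrier_mat q q" "diagonal_mat D" "a < p" "b < q"
  shows "(X * D) $$ (a, b) = X $$ (a, b) * D $$ (b, b)"
proof -
  have "(X * D) $$ (a, b) = (\<Sum>c<q. X $$ (a, c) * D $$ (c, b))"
    using assms by (simp add: scalar_prod_def atLeast0LessThan)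
  also have "\<dots> = (\<Sum>c<q. if c = b then X $$ (a, b) * D $$ (b, b) else 0)"
    using assms by (intro sum.cong) (auto simp: diagonal_mat_def)
  finally show ?thesis using assms by simp
qed

lemma mult_diagonal_mat_left_index:
  fixes X D :: "real mat"
  assumes "X \<in> carrier_mat q p" "D \<in> carrier_mat q q" "diagonal_mat D" "a < q" "b < p"
  shows "(D * X) $$ (a, b) = D $$ (a, a) * X $$ (a, b)"
proof -
  have "(D * X) $$ (a, b) = (\<Sum>c<q. D $$ (a, c) * X $$ (c, b))"
    using assms by (simp add: scalar_prod_def atLeast0LessThan)
  also have "\<dots> = (\<Sum>c<q. if c = a then D $$ (a, a) * X $$ (a, b) else 0)"
    using assms by (intro sum.cong) (auto simp: diagonal_mat_def)
  finally show ?thesis using assms by simp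
qed

lemma orthogonally_diagonalizable_commute:
  fixes X Y :: "real mat"
  assumes U: "U \<in> carrier_mat p p" "U\<^sup>T * U = 1\<^sub>m p"
    and X: "X \<in> carrier_mat p p" and Y: "Y \<in> carrier_mat p p"
    and diag: "diagonal_mat (mat_congr U X)" "diagonal_mat (mat_congr U Y)"
  shows "X * Y = Y * X"
proof -
  let ?X = "mat_congr U X" and ?Y = "mat_congr U Y"
  have UU: "U * U\<^sup>T = 1\<^sub>m p" using mat_mult_left_right_inverse[of "U\<^sup>T" p U] U by simp
  have c: "?X \<in> carrier_mat p p" "?Y \<in> carrier_mat p p" using U by auto
  have prod: "S * T = U * (mat_congr U S * mat_congr U T) * U\<^sup>T"
    if S: "S \<in> carrier_mat p p" and T: "T \<in> carrier_mat p p" for S T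
  proof -
    have "U * (mat_congr U S * mat_congr U T) * U\<^sup>T = (U * U\<^sup>T) * S * (U * U\<^sup>T) * T * (U * U\<^sup>T)"
      using U S T by (simp add: mat_congr_def assoc_mult_mat[of _ p p _ p _ p])
    then show ?thesis unfolding UU using S T by simp
  qed
  have "?X * ?Y = ?Y * ?X"
  proof (rule eq_matI)
    fix a b assume "a < dim_row (?Y * ?X)" "b < dim_col (?Y * ?X)"
    then have ab: "a < p" "b < p" using c by auto
    show "(?X * ?Y) $$ (a, b) = (?Y * ?X) $$ (a, b)"
      using mult_diagonal_mat_right_index[OF c(1,2) diag(2) ab] mult_diagonal_mat_left_index[OF c(1,2) diag(2) ab]
      using diag c ab by (cases "a = b") (auto simp: diagonal_mat_def)
  qed (use c in auto)
  then show ?thesis using prod[OF X Y] prod[OF Y X] by simp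
qed

lemma mat_lincomb_carrier [simp]: "mat_lincomb nr nc I c M \<in> carrier_mat nr nc"
  by (simp add: mat_lincomb_def)

lemma mat_lincomb_index:
  "a < nr \<Longrightarrow> b < nc \<Longrightarrow> mat_lincomb nr nc I c M $$ (a, b) = (\<Sum>i\<in>I. c i * M i $$ (a, b))"
  by (simp add: mat_lincomb_def)

text \<open>
Any solution of \<open>N\<^sub>i = W K\<^sub>i\<close> also satisfies the weighted sum \<open>D\<^sub>2 = W D\<^sub>3\<close> of these equations,
restricted to the first \<open>q\<close> columns. Thus those columns of \<open>W\<close> are \<open>D\<^sub>2 E\<close>, where \<open>E\<close> inverts
\<open>D\<^sub>3\<close>, and the remaining columns of \<open>W\<close> only ever meet zeros of \<open>K\<^sub>i\<close>.
\<close>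

lemma factor_through_weights:
  fixes N K :: "nat \<Rightarrow> real mat" and mu :: "nat \<Rightarrow> real"
  assumes K: "\<And>i. i \<in> I \<Longrightarrow> K i \<in> carrier_mat r r" and diagK: "\<And>i. i \<in> I \<Longrightarrow> diagonal_mat (K i)"
    and q: "q \<le> r" and zero: "\<And>i b. i \<in> I \<Longrightarrow> q \<le> b \<Longrightarrow> b < r \<Longrightarrow> K i $$ (b, b) = 0"
    and W: "W \<in> carrier_mat p r" and NW: "\<And>i. i \<in> I \<Longrightarrow> N i = W * K i"
  defines "A2 \<equiv> \<lambda>i. mat p q (\<lambda>(a, b). N i $$ (a, b))"
    and "A3 \<equiv> \<lambda>i. mat q q (\<lambda>(a, b). K i $$ (a, b))"
  defines "D2 \<equiv> mat_lincomb p q I mu A2" and "D3 \<equiv> mat_lincomb q q I mu A3"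
  assumes E: "E \<in> carrier_mat q q" "D3 * E = 1\<^sub>m q"
    and i: "i \<in> I"
  shows "\<And>a b. a < p \<Longrightarrow> q \<le> b \<Longrightarrow> b < r \<Longrightarrow> N i $$ (a, b) = 0"
    and "A2 i = D2 * E * A3 i"
    and "A2 i * E * D2\<^sup>T = W * (N i)\<^sup>T"
    and "(W * (N i)\<^sup>T)\<^sup>T = W * (N i)\<^sup>T"
proof -
  have N_index: "N j $$ (a, b) = W $$ (a, b) * K j $$ (b, b)" if "j \<in> I" "a < p" "b < r" for j a b
    unfolding NW[OF that(1)] using mult_diagonal_mat_right_index[OF W K diagK] that by blast
  have N: "N j \<in> carrier_mat p r" if "j \<in> I" for j using NW[OF that] W K[OF that] by simp
  show "N i $$ (a, b) = 0" if "a < p" "q \<le> b" "b < r" for a b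
    using N_index i that zero by simp
  define W' where "W' = mat p q (\<lambda>(a, b). W $$ (a, b))"
  have W': "W' \<in> carrier_mat p q" by (simp add: W'_def)
  have A2: "A2 j \<in> carrier_mat p q" and A3: "A3 j \<in> carrier_mat q q" for j by (auto simp: A2_def A3_def)
  have D2: "D2 \<in> carrier_mat p q" and D3: "D3 \<in> carrier_mat q q" by (auto simp: D2_def D3_def)
  have diagA3: "diagonal_mat (A3 j)" if "j \<in> I" for j
    using diagK[OF that] K[OF that] q by (auto simp: A3_def diagonal_mat_def)
  have "diagonal_mat D3"
    using diagA3 A3 by (auto simp: D3_def diagonal_mat_def mat_lincomb_def A3_def intro!: sum.neutral)
  have A2_eq: "A2 j = W' * A3 j" if j: "j \<in> I" for j
  proof (rule eq_matI)
    fix a b assume "a < dim_row (W' * A3 j)" "b < dim_col (W' * A3 j)"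
    then have ab: "a < p" "b < q" by (auto simp: W'_def A3_def)
    then show "A2 j $$ (a, b) = (W' * A3 j) $$ (a, b)"
      using mult_diagonal_mat_right_index[OF W' A3 diagA3[OF j] ab] N_index[OF j, of a b] q
      by (simp add: A2_def A3_def W'_def)
  qed (use A2[of j] A3[of j] W' in auto)
  have "D2 = W' * D3"
  proof (rule eq_matI)
    fix a b assume "a < dim_row (W' * D3)" "b < dim_col (W' * D3)"
    then have ab: "a < p" "b < q" using W' D3 by auto
    have "D2 $$ (a, b) = (\<Sum>j\<in>I. mu j * (W' $$ (a, b) * A3 j $$ (b, b)))"
      using ab A2_eq mult_diagonal_mat_right_index[OF W' A3 diagA3 ab]
      by (auto simp: D2_def mat_lincomb_index intro!: sum.cong)
    also have "\<dots> = W' $$ (a, b) * D3 $$ (b, b)"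
      using ab by (simp add: D3_def mat_lincomb_index sum_distrib_left mult_ac)
    finally show "D2 $$ (a, b) = (W' * D3) $$ (a, b)"
      using mult_diagonal_mat_right_index[OF W' D3 \<open>diagonal_mat D3\<close> ab] by simp
  qed (use D2 D3 W' in auto)
  then have "D2 * E = W' * (D3 * E)" using W' D3 E by (simp add: assoc_mult_mat[of _ p q _ q _ q])
  then have D2E: "D2 * E = W'" using E W' by simp
  show "A2 i = D2 * E * A3 i" using A2_eq[OF i] D2E by simp
  have symK: "(A3 i)\<^sup>T = A3 i" using diagA3[OF i] A3[of i]
    by (intro eq_matI) (auto simp: diagonal_mat_def, metis)
  have "D3\<^sup>T = D3" using \<open>diagonal_mat D3\<close> D3
    by (intro eq_matI) (auto simp: diagonal_mat_def, metis)
  have "E * D3 = 1\<^sub>m q" using mat_mult_left_right_inverse[OF D3 E] .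
  have "E * D2\<^sup>T = W'\<^sup>T"
  proof -
    have "D2\<^sup>T = D3\<^sup>T * W'\<^sup>T" unfolding \<open>D2 = W' * D3\<close> using W' D3 by (rule transpose_mult)
    then have "D2\<^sup>T = D3 * W'\<^sup>T" unfolding \<open>D3\<^sup>T = D3\<close> .
    then have "E * D2\<^sup>T = (E * D3) * W'\<^sup>T" using W' D3 E by (simp add: assoc_mult_mat[of _ q q _ q _ p])
    then show ?thesis unfolding \<open>E * D3 = 1\<^sub>m q\<close> using W' by simp
  qed
  then have lhs: "A2 i * E * D2\<^sup>T = W' * A3 i * W'\<^sup>T"
    using A2_eq[OF i] A2[of i] E D2 by (simp add: assoc_mult_mat[of _ p q _ q _ p])
  have rhs: "W * (N i)\<^sup>T = W' * A3 i * W'\<^sup>T"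
  proof (rule eq_matI)
    fix a c assume "a < dim_row (W' * A3 i * W'\<^sup>T)" "c < dim_col (W' * A3 i * W'\<^sup>T)"
    then have ac: "a < p" "c < p" using W' by auto
    have "(W * (N i)\<^sup>T) $$ (a, c) = (\<Sum>b<r. W $$ (a, b) * N i $$ (c, b))"
      using ac W N[OF i] by (simp add: scalar_prod_def atLeast0LessThan)
    also have "\<dots> = (\<Sum>b<q. W $$ (a, b) * N i $$ (c, b))"
      using q N_index[OF i ac(2)] zero[OF i] by (intro sum.mono_neutral_right) auto
    also have "\<dots> = (\<Sum>b<q. (W' * A3 i) $$ (a, b) * W' $$ (c, b))"
    proof (rule sum.cong)
      fix b assume "b \<in> {..<q}"
      then have b: "b < q" by simp
      show "W $$ (a, b) * N i $$ (c, b) = (W' * A3 i) $$ (a, b) * W' $$ (c, b)"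
        using mult_diagonal_mat_right_index[OF W' A3 diagA3[OF i] ac(1) b] N_index[OF i ac(2), of b] b q ac
        by (simp add: W'_def A3_def)
    qed simp
    also have "\<dots> = (W' * A3 i * W'\<^sup>T) $$ (a, c)"
    proof -
      have "(\<Sum>b<q. Y $$ (a, b) * W' $$ (c, b)) = (Y * W'\<^sup>T) $$ (a, c)" if "Y \<in> carrier_mat p q" for Y
        using that ac W' by (simp add: scalar_prod_def atLeast0LessThan)
      from this[OF mult_carrier_mat[OF W' A3]] show ?thesis .
    qed
    finally show "(W * (N i)\<^sup>T) $$ (a, c) = (W' * A3 i * W'\<^sup>T) $$ (a, c)" .
  qed (use W W' N[OF i] in auto)
  show "A2 i * E * D2\<^sup>T = W * (N i)\<^sup>T" unfolding lhs rhs ..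
  show "(W * (N i)\<^sup>T)\<^sup>T = W * (N i)\<^sup>T"
    unfolding rhs using mat_congr_symmetric[of "W'\<^sup>T" q p "A3 i"] W' A3[of i] symK
    by (simp add: mat_congr_def)
qed

text \<open>
In one direction the shear \<open>W\<close> comes from the diagonalizing congruence; in the other it is built by
extending \<open>D\<^sub>2 E\<close> with zero columns. Both times \<open>R i\<close> is the block \<open>M\<^sub>i - W N\<^sub>i\<^sup>T\<close> left by the
elimination, so commuting is what an orthogonal diagonalization of these blocks amounts to.
\<close>

lemma simultaneous_block_diagonalization_iff:
  fixes N K :: "nat \<Rightarrow> real mat" and mu :: "nat \<Rightarrow> real"
  assumes fin: "finite I"
    and M1: "\<And>i. i \<in> I \<Longrightarrow> M1 i \<in> carrier_mat p p" and symM1: "\<And>i. i \<in> I \<Longrightarrow> (M1 i)\<^sup>T = M1 i"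
    and N: "\<And>i. i \<in> I \<Longrightarrow> N i \<in> carrier_mat p r"
    and K: "\<And>i. i \<in> I \<Longrightarrow> K i \<in> carrier_mat r r" and diagK: "\<And>i. i \<in> I \<Longrightarrow> diagonal_mat (K i)"
    and q: "q \<le> r" and zero: "\<And>i b. i \<in> I \<Longrightarrow> q \<le> b \<Longrightarrow> b < r \<Longrightarrow> K i $$ (b, b) = 0"
  defines "A2 \<equiv> \<lambda>i. mat p q (\<lambda>(a, b). N i $$ (a, b))"
    and "A3 \<equiv> \<lambda>i. mat q q (\<lambda>(a, b). K i $$ (a, b))"
  defines "D2 \<equiv> mat_lincomb p q I mu A2" and "D3 \<equiv> mat_lincomb q q I mu A3"
  assumes E: "E \<in> carrier_mat q q" "D3 * E = 1\<^sub>m q"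
  defines "R \<equiv> \<lambda>i. M1 i - A2 i * E * D2\<^sup>T"
  shows "(\<exists>P \<in> carrier_mat (p + r) (p + r). invertible_mat P \<and>
      diagonal_mat (mat_congr P (partial_identity p r)) \<and>
      (\<forall>i\<in>I. diagonal_mat (mat_congr P (four_block_mat (M1 i) (N i) (N i)\<^sup>T (K i))))) \<longleftrightarrow>
    (\<forall>i\<in>I. \<forall>a<p. \<forall>b. q \<le> b \<and> b < r \<longrightarrow> N i $$ (a, b) = 0) \<and>
    (\<forall>i\<in>I. A2 i = D2 * E * A3 i) \<and> (\<forall>i\<in>I. \<forall>j\<in>I. R i * R j = R j * R i)"
    (is "?L \<longleftrightarrow> ?c1 \<and> ?c2 \<and> ?c3")
proof -
  have symK: "(K i)\<^sup>T = K i" if "i \<in> I" for i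
    using diagK[OF that] K[OF that] by (intro eq_matI) (auto simp: diagonal_mat_def, metis)
  have factor: "(\<forall>a<p. \<forall>b. q \<le> b \<and> b < r \<longrightarrow> N i $$ (a, b) = 0) \<and> A2 i = D2 * E * A3 i \<and>
      R i = M1 i - W * (N i)\<^sup>T \<and> (W * (N i)\<^sup>T)\<^sup>T = W * (N i)\<^sup>T"
    if W: "W \<in> carrier_mat p r" and NW: "\<And>i. i \<in> I \<Longrightarrow> N i = W * K i" and i: "i \<in> I" for W i
  proof -
    note weights = factor_through_weights[OF K diagK q zero W NW E(1) E(2)[unfolded D3_def A3_def] i]
    have "N i $$ (a, b) = 0" if "a < p" "q \<le> b" "b < r" for a b
      by (rule weights(1)) (use that in auto)
    moreover have "A2 i = D2 * E * A3 i" unfolding A2_def A3_def D2_def by (rule weights(2))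
    moreover have "R i = M1 i - W * (N i)\<^sup>T" unfolding R_def A2_def D2_def by (simp only: weights(3))
    moreover have "(W * (N i)\<^sup>T)\<^sup>T = W * (N i)\<^sup>T" by (rule weights(4))
    ultimately show ?thesis by blast
  qed
  show ?thesis
  proof
    assume ?L
    then obtain P where P: "P \<in> carrier_mat (p + r) (p + r)" "invertible_mat P"
        "diagonal_mat (mat_congr P (partial_identity p r))"
        "\<And>i. i \<in> I \<Longrightarrow> diagonal_mat (mat_congr P (four_block_mat (M1 i) (N i) (N i)\<^sup>T (K i)))"
      by blast
    obtain U V W where U: "U \<in> carrier_mat p p" "U\<^sup>T * U = 1\<^sub>m p" and W: "W \<in> carrier_mat p r"
      and NW: "\<And>i. i \<in> I \<Longrightarrow> N i = W * K i"
      and diag: "\<And>i. i \<in> I \<Longrightarrow> diagonal_mat (mat_congr U (M1 i - W * (N i)\<^sup>T))"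
      by (rule simultaneous_block_diagonalization_necessary[OF M1 N K symK P]) blast+
    have R: "R i = M1 i - W * (N i)\<^sup>T" if "i \<in> I" for i
      using factor[OF W NW that] by blast
    have "R i * R j = R j * R i" if ij: "i \<in> I" "j \<in> I" for i j
      unfolding R[OF ij(1)] R[OF ij(2)]
      using diag ij N W by (intro orthogonally_diagonalizable_commute[OF U]) (auto intro!: minus_carrier_mat)
    moreover have ?c1 using factor[OF W NW] by blast
    moreover have ?c2 using factor[OF W NW] by blast
    ultimately show "?c1 \<and> ?c2 \<and> ?c3" by blast
  next
    assume *: "?c1 \<and> ?c2 \<and> ?c3"
    define W where "W = mat p r (\<lambda>(a, b). if b < q then (D2 * E) $$ (a, b) else 0)"
    have W: "W \<in> carrier_mat p r" by (simp add: W_def)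
    have D2E: "D2 * E \<in> carrier_mat p q" unfolding D2_def by (rule mult_carrier_mat[OF mat_lincomb_carrier E(1)])
    have NW: "N i = W * K i" if i: "i \<in> I" for i
    proof (rule eq_matI)
      fix a b assume "a < dim_row (W * K i)" "b < dim_col (W * K i)"
      then have ab: "a < p" "b < r" using W K[OF i] by auto
      have A3: "A3 i \<in> carrier_mat q q" "diagonal_mat (A3 i)"
        using diagK[OF i] K[OF i] q by (auto simp: A3_def diagonal_mat_def)
      have "N i $$ (a, b) = W $$ (a, b) * K i $$ (b, b)"
      proof (cases "b < q")
        case True
        have "N i $$ (a, b) = A2 i $$ (a, b)" using ab True by (simp add: A2_def)
        also have "A2 i = D2 * E * A3 i" using * i by blast
        also have "\<dots> $$ (a, b) = (D2 * E) $$ (a, b) * A3 i $$ (b, b)"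
          by (rule mult_diagonal_mat_right_index[OF D2E A3 ab(1) True])
        finally show ?thesis using ab True by (simp add: W_def A3_def)
      next
        case False
        then show ?thesis using * i ab by (simp add: W_def)
      qed
      then show "N i $$ (a, b) = (W * K i) $$ (a, b)"
        using mult_diagonal_mat_right_index[OF W K[OF i] diagK[OF i] ab] by simp
    qed (use W K[OF i] N[OF i] in auto)
    have R: "R i = M1 i - W * (N i)\<^sup>T" if "i \<in> I" for i
      using factor[OF W NW that] by blast
    have Rc: "R i \<in> carrier_mat p p" if "i \<in> I" for i
      unfolding R[OF that] using W N[OF that] by (intro minus_carrier_mat) auto
    have Rsym: "(R i)\<^sup>T = R i" if i: "i \<in> I" for i
    proof -
      have "(W * (N i)\<^sup>T)\<^sup>T = W * (N i)\<^sup>T" using factor[OF W NW i] by blast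
      then show ?thesis unfolding R[OF i]
        using M1[OF i] W N[OF i] symM1[OF i] by (subst transpose_minus[of _ p p]) auto
    qed
    obtain U where U: "U \<in> carrier_mat p p" "U\<^sup>T * U = 1\<^sub>m p"
        "\<And>i. i \<in> I \<Longrightarrow> diagonal_mat (mat_congr U (R i))"
      using commuting_symmetric_orthogonally_diagonalizable[of I R p, OF fin Rc Rsym] * by blast
    have one: "invertible_mat (1\<^sub>m r :: real mat)" by (intro invertible_matI[of _ r "1\<^sub>m r"]) auto
    have diag1: "diagonal_mat (mat_congr (1\<^sub>m r) (K i))" if "i \<in> I" for i
      using K[OF that] diagK[OF that] by (simp add: mat_congr_def)
    have diagR: "diagonal_mat (mat_congr U (M1 i - W * (N i)\<^sup>T))" if "i \<in> I" for i
      using U(3)[OF that] R[OF that] by simp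
    obtain P where P: "P \<in> carrier_mat (p + r) (p + r)" "invertible_mat P"
        "diagonal_mat (mat_congr P (partial_identity p r))"
        "\<And>i. i \<in> I \<Longrightarrow> diagonal_mat (mat_congr P (four_block_mat (M1 i) (N i) (N i)\<^sup>T (K i)))"
      by (rule simultaneous_block_diagonalization_sufficient[OF M1 N K symK U(1,2) one_carrier_mat one W
            NW diag1 diagR]) auto
    then show ?L by blast
  qed
qed

section \<open>Weights with a nonsingular combination\<close>

lemma diagonal_mat_lincomb:
  assumes diag: "\<And>i. i \<in> I \<Longrightarrow> diagonal_mat (M i)" and M: "\<And>i. i \<in> I \<Longrightarrow> M i \<in> carrier_mat n n"
  shows "diagonal_mat (mat_lincomb n n I c M)"
proof -
  have "M i $$ (a, b) = 0" if "i \<in> I" "a < n" "b < n" "a \<noteq> b" for i a b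
    using diag[OF that(1)] M[OF that(1)] that by (auto simp: diagonal_mat_def)
  then show ?thesis by (auto simp: diagonal_mat_def mat_lincomb_def intro!: sum.neutral)
qed

text \<open>
Weights not yet treated are zero, so the current matrix is the full weighted sum at every stage. The
support equation in each step makes its support the union of all supports seen so far.
\<close>

lemma weight_search_invariant:
  assumes "weight_search m q B j mu D" and "m \<ge> 2"
    and B: "\<And>i. i \<in> {1..m - 1} \<Longrightarrow> B i \<in> carrier_mat q q"
  shows "1 \<le> j \<and> j \<le> m - 1 \<and> (\<forall>i>j. mu i = 0) \<and> D = mat_lincomb q q {1..m - 1} mu B \<and>
    diag_supp D = (\<Union>i\<in>{1..j}. diag_supp (B i))"
  using assms(1)
proof induction
  case start
  have one: "1 \<in> {1..m - 1}" using \<open>m \<ge> 2\<close> by simp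
  have "B 1 = mat_lincomb q q {1..m - 1} (\<lambda>i. if i = 1 then 1 else 0) B"
  proof (rule eq_matI)
    fix a b assume "a < dim_row (mat_lincomb q q {1..m - 1} (\<lambda>i. if i = 1 then 1 else 0) B)"
      "b < dim_col (mat_lincomb q q {1..m - 1} (\<lambda>i. if i = 1 then 1 else 0) B)"
    then have ab: "a < q" "b < q" by (auto simp: mat_lincomb_def)
    have "(\<Sum>i\<in>{1..m - 1}. (if i = 1 then 1 else 0) * B i $$ (a, b)) =
        (\<Sum>i\<in>{1..m - 1}. if i = 1 then B 1 $$ (a, b) else 0)"
      by (intro sum.cong) auto
    then show "B 1 $$ (a, b) = mat_lincomb q q {1..m - 1} (\<lambda>i. if i = 1 then 1 else 0) B $$ (a, b)"
      using ab \<open>m \<ge> 2\<close> by (simp add: mat_lincomb_index)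
  qed (use B[OF one] in \<open>auto simp: mat_lincomb_def\<close>)
  then show ?case using \<open>m \<ge> 2\<close> by auto
next
  case (step j mu D s w D')
  have j: "j + 1 \<in> {1..m - 1}" using step.hyps(2) \<open>m \<ge> 2\<close> by simp
  have D: "D = mat_lincomb q q {1..m - 1} mu B" and mu0: "mu (j + 1) = 0" using step.IH by auto
  have "D' = mat_lincomb q q {1..m - 1} (mu(j + 1 := w)) B"
  proof (rule eq_matI)
    fix a b assume "a < dim_row (mat_lincomb q q {1..m - 1} (mu(j + 1 := w)) B)"
      "b < dim_col (mat_lincomb q q {1..m - 1} (mu(j + 1 := w)) B)"
    then have ab: "a < q" "b < q" by (auto simp: mat_lincomb_def)
    have "(\<Sum>i\<in>{1..m - 1}. (mu(j + 1 := w)) i * B i $$ (a, b)) =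
        (\<Sum>i\<in>{1..m - 1}. mu i * B i $$ (a, b) + (if i = j + 1 then w * B (j + 1) $$ (a, b) else 0))"
      using mu0 by (intro sum.cong) auto
    also have "\<dots> = (\<Sum>i\<in>{1..m - 1}. mu i * B i $$ (a, b)) + w * B (j + 1) $$ (a, b)"
      using j by (simp add: sum.distrib)
    finally show "D' $$ (a, b) = mat_lincomb q q {1..m - 1} (mu(j + 1 := w)) B $$ (a, b)"
      using ab B[OF j] by (simp add: step.hyps(6) D mat_lincomb_index)
  qed (use B[OF j] step.hyps(6) in \<open>auto simp: mat_lincomb_def\<close>)
  moreover have "diag_supp D' = (\<Union>i\<in>{1..j + 1}. diag_supp (B i))"
  proof -
    have "diag_supp D = (\<Union>i\<in>{1..j}. diag_supp (B i))" using step.IH by blast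
    then show ?thesis unfolding step.hyps(7) by (simp add: atLeastAtMostSuc_conv Un_commute)
  qed
  moreover have "\<forall>i>j + 1. (mu(j + 1 := w)) i = 0" using step.IH by auto
  moreover have "1 \<le> j + 1" "j + 1 \<le> m - 1" using j by auto
  ultimately show ?case by blast
qed

text \<open>
If the search runs to the end, the support of the sum is the union of all supports, hence everything;
if it stops earlier, the sum is nonsingular by the stopping rule. For \<open>q = 0\<close> the determinant of
the empty matrix is 1.
\<close>

lemma search_weights_nonsingular:
  assumes "search_weights m q B mu" and "m \<ge> 2"
    and B: "\<And>i. i \<in> {1..m - 1} \<Longrightarrow> B i \<in> carrier_mat q q"
    and diag: "\<And>i. i \<in> {1..m - 1} \<Longrightarrow> diagonal_mat (B i)"
    and nonzero: "\<And>b. b < q \<Longrightarrow> \<exists>i\<in>{1..m - 1}. B i $$ (b, b) \<noteq> 0"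
  defines "D \<equiv> mat_lincomb q q {1..m - 1} mu B"
  shows "\<exists>E \<in> carrier_mat q q. mat_inverse D = Some E \<and> D * E = 1\<^sub>m q"
proof -
  have D: "D \<in> carrier_mat q q" by (simp add: D_def)
  have diagD: "diagonal_mat D"
    unfolding D_def using diag B by (rule diagonal_mat_lincomb)
  have det: "det D \<noteq> 0"
  proof (cases "q = 0")
    case False
    then obtain j D' where ws: "weight_search m q B j mu D'" and stop: "j = m - 1 \<or> invertible_mat D'"
      using assms(1) by (auto simp: search_weights_def)
    note inv = weight_search_invariant[OF ws \<open>m \<ge> 2\<close> B]
    have D': "D' = D" using inv by (simp add: D_def)
    from stop show ?thesis
    proof
      assume "invertible_mat D'"
      then show ?thesis using D' D invertible_mat_iff_det by blast
    next
      assume j: "j = m - 1"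
      have "D $$ (b, b) \<noteq> 0" if b: "b < q" for b
      proof -
        obtain i where i: "i \<in> {1..m - 1}" "B i $$ (b, b) \<noteq> 0" using nonzero b by blast
        then have "b \<in> diag_supp (B i)" using B[OF i(1)] b by (simp add: diag_supp_def)
        then have "b \<in> diag_supp D" using inv i(1) j D' by blast
        then show ?thesis by (simp add: diag_supp_def)
      qed
      moreover have "upper_triangular D" using diagD D by (auto simp: diagonal_mat_def)
      ultimately show ?thesis using D
        by (auto simp: det_upper_triangular[OF _ D] diag_mat_def prod_list_zero_iff)
    qed
  qed (use D in simp)
  then have "D \<in> Units (ring_mat TYPE(real) q ())" by (rule det_non_zero_imp_unit[OF D])
  then obtain E where E: "mat_inverse D = Some E" using mat_inverse(1)[OF D, of "()"] by (cases "mat_inverse D") auto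
  then show ?thesis using mat_inverse(2)[OF D E] by blast
qed

section \<open>The equivalence\<close>

lemma submatrix_interval:
  assumes "M \<in> carrier_mat nr nc" "b \<le> nr" "d \<le> nc"
  shows "submatrix M {a..<b} {c..<d} = mat (b - a) (d - c) (\<lambda>(i, j). M $$ (a + i, c + j))"
proof -
  have pick: "pick {a..<b} i = a + i" if "i < b - a" for a b i :: nat
  proof -
    have "{x \<in> {a..<b}. x < a + i} = {a..<a + i}" using that by auto
    then show ?thesis using pick_card_in_set[of "a + i" "{a..<b}"] that by simp
  qed
  have "{i. i < dim_row M \<and> i \<in> {a..<b}} = {a..<b}" "{j. j < dim_col M \<and> j \<in> {c..<d}} = {c..<d}"
    using assms by auto
  then show ?thesis unfolding submatrix_def
    by (intro eq_matI) (auto simp: pick)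
qed

lemma diag_block_mat_pair:
  "diag_block_mat [A, B] = four_block_mat A (0\<^sub>m (dim_row A) (dim_col B)) (0\<^sub>m (dim_row B) (dim_col A)) B"
proof -
  have "four_block_mat B (0\<^sub>m (dim_row B) 0) (0\<^sub>m 0 (dim_col B)) (0\<^sub>m 0 0) = B"
    by (rule eq_matI) auto
  then show ?thesis by (simp add: Let_def)
qed

lemma mat_congr_lincomb:
  assumes P: "P \<in> carrier_mat n n" and M: "\<And>i. i \<in> I \<Longrightarrow> M i \<in> carrier_mat n n"
  shows "mat_congr P (mat_lincomb n n I c M) = mat_lincomb n n I c (\<lambda>i. mat_congr P (M i))"
proof (rule eq_matI)
  fix a b assume "a < dim_row (mat_lincomb n n I c (\<lambda>i. mat_congr P (M i)))"
    "b < dim_col (mat_lincomb n n I c (\<lambda>i. mat_congr P (M i)))"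
  then have ab: "a < n" "b < n" by (auto simp: mat_lincomb_def)
  have "mat_congr P (mat_lincomb n n I c M) $$ (a, b) =
      (\<Sum>k<n. \<Sum>l<n. \<Sum>i\<in>I. c i * (P $$ (k, a) * M i $$ (k, l) * P $$ (l, b)))"
    using mat_congr_index[OF P mat_lincomb_carrier ab]
    by (simp add: mat_lincomb_index sum_distrib_left sum_distrib_right mult_ac)
  also have "\<dots> = (\<Sum>i\<in>I. \<Sum>k<n. \<Sum>l<n. c i * (P $$ (k, a) * M i $$ (k, l) * P $$ (l, b)))"
    by (subst sum.swap[of _ I], subst (2) sum.swap[of _ _ I], rule refl)
  also have "\<dots> = (\<Sum>i\<in>I. c i * mat_congr P (M i) $$ (a, b))"
    using mat_congr_index[OF P M ab] by (intro sum.cong) (simp_all add: sum_distrib_left)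
  finally show "mat_congr P (mat_lincomb n n I c M) $$ (a, b) =
      mat_lincomb n n I c (\<lambda>i. mat_congr P (M i)) $$ (a, b)"
    using ab by (simp add: mat_lincomb_index)
qed (use P in \<open>auto simp: mat_congr_def mat_lincomb_def\<close>)

text \<open>
The replaced matrix is recovered as a combination of the new family because its coefficient is nonzero;
\<open>c\<close> lists the coefficients of this recovery.
\<close>

lemma sim_diag_congr_replace_by_lincomb:
  assumes fin: "finite I" and k: "k \<in> I" and lam: "lam k \<noteq> 0"
    and A: "\<And>i. i \<in> I \<Longrightarrow> A i \<in> carrier_mat n n"
  shows "sim_diag_congr n I A \<longleftrightarrow> sim_diag_congr n I (A(k := mat_lincomb n n I lam A))"
    (is "_ \<longleftrightarrow> sim_diag_congr n I ?A'")
proof -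
  have A': "?A' i \<in> carrier_mat n n" if "i \<in> I" for i using A that by simp
  define c where "c i = (if i = k then 1 / lam k else - lam i / lam k)" for i
  have recover: "A k = mat_lincomb n n I c ?A'"
  proof (rule eq_matI)
    fix a b assume "a < dim_row (mat_lincomb n n I c ?A')" "b < dim_col (mat_lincomb n n I c ?A')"
    then have ab: "a < n" "b < n" by (auto simp: mat_lincomb_def)
    let ?s = "\<Sum>i\<in>I - {k}. lam i * A i $$ (a, b)"
    have "(\<Sum>i\<in>I. lam i * A i $$ (a, b)) = lam k * A k $$ (a, b) + ?s"
      using fin k by (simp add: sum.remove)
    moreover have "(\<Sum>i\<in>I. c i * ?A' i $$ (a, b)) =
        1 / lam k * mat_lincomb n n I lam A $$ (a, b) + (\<Sum>i\<in>I - {k}. - lam i / lam k * A i $$ (a, b))"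
      using fin k by (simp add: sum.remove c_def)
    moreover have "(\<Sum>i\<in>I - {k}. - lam i / lam k * A i $$ (a, b)) = - ?s / lam k"
      by (simp add: sum_divide_distrib sum_negf)
    ultimately show "A k $$ (a, b) = mat_lincomb n n I c ?A' $$ (a, b)"
      using ab lam by (simp add: mat_lincomb_index field_simps)
  qed (use A[OF k] in \<open>auto simp: mat_lincomb_def\<close>)
  have "(\<forall>i\<in>I. diagonal_mat (mat_congr P (A i))) \<longleftrightarrow> (\<forall>i\<in>I. diagonal_mat (mat_congr P (?A' i)))"
    if P: "P \<in> carrier_mat n n" for P
  proof
    assume d: "\<forall>i\<in>I. diagonal_mat (mat_congr P (A i))"
    have eq: "mat_congr P (mat_lincomb n n I lam A) = mat_lincomb n n I lam (\<lambda>i. mat_congr P (A i))"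
      by (rule mat_congr_lincomb[OF P A])
    have "diagonal_mat (mat_congr P (mat_lincomb n n I lam A))"
      unfolding eq by (rule diagonal_mat_lincomb) (use d P in auto)
    then show "\<forall>i\<in>I. diagonal_mat (mat_congr P (?A' i))" using d by simp
  next
    assume d: "\<forall>i\<in>I. diagonal_mat (mat_congr P (?A' i))"
    have eq: "mat_congr P (mat_lincomb n n I c ?A') = mat_lincomb n n I c (\<lambda>i. mat_congr P (?A' i))"
      by (rule mat_congr_lincomb[OF P A'])
    have "diagonal_mat (mat_congr P (mat_lincomb n n I c ?A'))"
      unfolding eq by (rule diagonal_mat_lincomb) (use d P in auto)
    then have "diagonal_mat (mat_congr P (A k))" by (simp only: recover[symmetric])
    then show "\<forall>i\<in>I. diagonal_mat (mat_congr P (A i))" using d by (metis fun_upd_other)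
  qed
  then show ?thesis unfolding sim_diag_congr_def by blast
qed

lemma sim_diag_congr_mat_congr_iff:
  assumes Q: "Q \<in> carrier_mat n n" "invertible_mat Q"
    and M: "\<And>i. i \<in> I \<Longrightarrow> M i \<in> carrier_mat n n"
  shows "sim_diag_congr n I (\<lambda>i. mat_congr Q (M i)) \<longleftrightarrow> sim_diag_congr n I M"
proof
  assume "sim_diag_congr n I (\<lambda>i. mat_congr Q (M i))"
  then obtain P where P: "P \<in> carrier_mat n n" "invertible_mat P"
      "\<forall>i\<in>I. diagonal_mat (mat_congr P (mat_congr Q (M i)))"
    by (auto simp: sim_diag_congr_def)
  have "invertible_mat (Q * P)"
    using P Q invertible_mat_iff_det[of _ n] det_mult[OF Q(1) P(1)] by simp
  moreover have "diagonal_mat (mat_congr (Q * P) (M i))" if "i \<in> I" for i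
    using P(3) that mat_congr_mult[OF Q(1) P(1) M[OF that]] by simp
  ultimately show "sim_diag_congr n I M"
    using mult_carrier_mat[OF Q(1) P(1)] by (auto simp: sim_diag_congr_def)
next
  assume "sim_diag_congr n I M"
  then obtain P where P: "P \<in> carrier_mat n n" "invertible_mat P"
      "\<forall>i\<in>I. diagonal_mat (mat_congr P (M i))"
    by (auto simp: sim_diag_congr_def)
  obtain Q' where Q': "Q' \<in> carrier_mat n n" "Q' * Q = 1\<^sub>m n" "Q * Q' = 1\<^sub>m n"
    by (rule invertible_matE[OF Q])
  have "invertible_mat Q'" by (rule invertible_matI[OF Q'(1) Q(1) Q'(3)])
  then have "invertible_mat (Q' * P)"
    using P Q' invertible_mat_iff_det[of _ n] det_mult[OF Q'(1) P(1)] by simp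
  moreover have "diagonal_mat (mat_congr (Q' * P) (mat_congr Q (M i)))" if i: "i \<in> I" for i
  proof -
    have "mat_congr (Q' * P) (mat_congr Q (M i)) = mat_congr (Q * (Q' * P)) (M i)"
      using mat_congr_mult[OF Q(1) mult_carrier_mat[OF Q'(1) P(1)] M[OF i]] by simp
    also have "Q * (Q' * P) = P"
      using P Q Q' by (simp flip: assoc_mult_mat[of _ n n _ n _ n])
    finally show ?thesis using P(3) i by simp
  qed
  ultimately show "sim_diag_congr n I (\<lambda>i. mat_congr Q (M i))"
    using mult_carrier_mat[OF Q'(1) P(1)] by (auto simp: sim_diag_congr_def)
qed

lemma mat_lincomb_cong:
  "(\<And>i. i \<in> I \<Longrightarrow> M i = M' i) \<Longrightarrow> mat_lincomb nr nc I c M = mat_lincomb nr nc I c M'"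
  by (simp add: mat_lincomb_def cong: sum.cong)

lemma symmetric_four_block_mat:
  fixes M :: "real mat"
  assumes M: "M \<in> carrier_mat (p + r) (p + r)" and sym: "M\<^sup>T = M"
  shows "M = four_block_mat (submatrix M {0..<p} {0..<p}) (submatrix M {0..<p} {p..<p + r})
      (submatrix M {0..<p} {p..<p + r})\<^sup>T (submatrix M {p..<p + r} {p..<p + r})"
    (is "M = ?B")
proof (rule eq_matI)
  have sub: "submatrix M {0..<p} {0..<p} = mat p p (\<lambda>(i, j). M $$ (i, j))"
    "submatrix M {0..<p} {p..<p + r} = mat p r (\<lambda>(i, j). M $$ (i, p + j))"
    "submatrix M {p..<p + r} {p..<p + r} = mat r r (\<lambda>(i, j). M $$ (p + i, p + j))"
    using M by (simp_all add: submatrix_interval[of _ "p + r" "p + r"])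
  have swap: "M $$ (i, j) = M $$ (j, i)" if "i < p + r" "j < p + r" for i j
    using sym M that by (metis carrier_matD index_transpose_mat(1))
  show "dim_row M = dim_row ?B" "dim_col M = dim_col ?B" using M by (simp_all add: sub)
  fix i j assume "i < dim_row ?B" "j < dim_col ?B"
  then have "i < p + r" "j < p + r" by (simp_all add: sub)
  then show "M $$ (i, j) = ?B $$ (i, j)"
    using swap[of i j] by (auto simp: sub)
qed

theorem theorem3p6:
  fixes n m p q :: nat
    and A :: "nat \<Rightarrow> real mat"
    and lam mu :: "nat \<Rightarrow> real"
    and Q1 V :: "real mat"
  defines "At \<equiv> mat_lincomb n n {1..m} lam A"
  defines "cA \<equiv> \<lambda>i. mat_congr Q1 (if i = m then At else A i)"
  defines "cA3 \<equiv> \<lambda>i. submatrix (cA i) {p..<n} {p..<n}"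
  defines "Q2 \<equiv> diag_block_mat [1\<^sub>m p, V]"
  defines "bA \<equiv> \<lambda>i. mat_congr Q2 (cA i)"
  defines "bA1 \<equiv> \<lambda>i. submatrix (bA i) {0..<p} {0..<p}"
  defines "bA2 \<equiv> \<lambda>i. submatrix (bA i) {0..<p} {p..<p + q}"
  defines "bA3 \<equiv> \<lambda>i. submatrix (bA i) {p..<p + q} {p..<p + q}"
  defines "bA4 \<equiv> \<lambda>i. submatrix (bA i) {0..<p} {p + q..<n}"
  defines "D2 \<equiv> mat_lincomb p q {1..m - 1} mu bA2"
  defines "D3 \<equiv> mat_lincomb q q {1..m - 1} mu bA3"
  defines "D3inv \<equiv> the (mat_inverse D3)"
  defines "R \<equiv> \<lambda>i. bA1 i - bA2 i * D3inv * D2\<^sup>T"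
  assumes "m \<ge> 2"
    and "\<And>i. i \<in> {1..m} \<Longrightarrow> A i \<in> carrier_mat n n"
    and "\<And>i. i \<in> {1..m} \<Longrightarrow> symmetric_mat (A i)"
    and "\<not> (\<exists>l :: nat \<Rightarrow> real. pos_def_mat n (mat_lincomb n n {1..m} l A))"
    and "pos_semidef_mat n At"
    and "lam m \<noteq> 0"
    and "Q1 \<in> carrier_mat n n"
    and "invertible_mat Q1"
    and "p < n"
    and "mat_congr Q1 At =
      four_block_mat (1\<^sub>m p) (0\<^sub>m p (n - p)) (0\<^sub>m (n - p) p) (0\<^sub>m (n - p) (n - p))"
    and "sim_diag_congr (n - p) {1..m} cA3 \<Longrightarrow>
      ordered_sd_witness (n - p) {1..m} cA3 q V \<and> search_weights m q bA3 mu"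
  shows "(sim_diag_congr n {1..m} A \<longleftrightarrow> sim_diag_congr n {1..m} (A(m := At))) \<and>
    (sim_diag_congr n {1..m} (A(m := At)) \<longleftrightarrow>
      sim_diag_congr (n - p) {1..m} cA3 \<and>
      (\<forall>i\<in>{1..m - 1}. bA4 i = 0\<^sub>m p (n - p - q)) \<and>
      (\<forall>i\<in>{1..m - 1}. bA2 i = D2 * D3inv * bA3 i) \<and>
      (\<forall>i\<in>{1..m - 1}. \<forall>j\<in>{1..m - 1}. R i * R j = R j * R i))"
proof -
  define r where "r = n - p"
  have n: "n = p + r" using \<open>p < n\<close> by (simp add: r_def)
  define I where "I = {1..m - 1}"
  have insm: "{1..m} = insert m I" and mI: "m \<in> {1..m}" and II: "I \<subseteq> {1..m}"
    using \<open>m \<ge> 2\<close> by (auto simp: I_def)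
  let ?A' = "A(m := At)"
  have At: "At \<in> carrier_mat n n" "At\<^sup>T = At"
    using \<open>pos_semidef_mat n At\<close> by (auto simp: pos_semidef_mat_def symmetric_mat_def)
  have A: "A i \<in> carrier_mat n n" "(A i)\<^sup>T = A i" if "i \<in> {1..m}" for i
    using assms(15)[OF that] assms(16)[OF that] by (auto simp: symmetric_mat_def)
  have A': "?A' i \<in> carrier_mat n n" "(?A' i)\<^sup>T = ?A' i" if "i \<in> {1..m}" for i
    using A[OF that] At by auto
  have cA_eq: "cA = (\<lambda>i. mat_congr Q1 (?A' i))" by (auto simp: cA_def)
  have Q1: "Q1 \<in> carrier_mat n n" "invertible_mat Q1" by fact+
  have ab: "sim_diag_congr n {1..m} A \<longleftrightarrow> sim_diag_congr n {1..m} ?A'"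
    unfolding At_def using mI \<open>lam m \<noteq> 0\<close> A(1)
    by (intro sim_diag_congr_replace_by_lincomb) auto
  have SD_cA: "sim_diag_congr n {1..m} cA \<longleftrightarrow> sim_diag_congr n {1..m} ?A'"
    unfolding cA_eq by (rule sim_diag_congr_mat_congr_iff[OF Q1 A'(1)])
  have cA: "cA i \<in> carrier_mat (p + r) (p + r)" for i
    unfolding cA_eq n[symmetric] by (rule mat_congr_carrier[OF Q1(1)])
  have cA_sym: "(cA i)\<^sup>T = cA i" if "i \<in> {1..m}" for i
    unfolding cA_eq by (rule mat_congr_symmetric[OF Q1(1) A'[OF that]])
  have cAm: "cA m = partial_identity p r"
    using assms(23) by (simp add: cA_eq r_def)
  define X where "X i = submatrix (cA i) {0..<p} {0..<p}" for i
  define N0 where "N0 i = submatrix (cA i) {0..<p} {p..<p + r}" for i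
  have cA3_def': "cA3 i = submatrix (cA i) {p..<p + r} {p..<p + r}" for i
    by (simp add: cA3_def n)
  have sub: "X i = mat p p (\<lambda>(a, b). cA i $$ (a, b))"
    "N0 i = mat p r (\<lambda>(a, b). cA i $$ (a, p + b))"
    "cA3 i = mat r r (\<lambda>(a, b). cA i $$ (p + a, p + b))" for i
    unfolding X_def N0_def cA3_def' using cA[of i] by (simp_all add: submatrix_interval[of _ "p + r" "p + r"])
  have X: "X i \<in> carrier_mat p p" and N0: "N0 i \<in> carrier_mat p r" and cA3: "cA3 i \<in> carrier_mat r r" for i
    by (simp_all add: sub)
  have swap: "cA i $$ (a, b) = cA i $$ (b, a)" if "i \<in> {1..m}" "a < p + r" "b < p + r" for i a b
    using cA_sym[OF that(1)] cA[of i] that by (metis carrier_matD index_transpose_mat(1))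
  have Xsym: "(X i)\<^sup>T = X i" and cA3sym: "(cA3 i)\<^sup>T = cA3 i" if "i \<in> {1..m}" for i
    using swap[OF that] by (auto simp: sub intro!: eq_matI)
  have blk: "cA i = four_block_mat (X i) (N0 i) (N0 i)\<^sup>T (cA3 i)" if "i \<in> {1..m}" for i
    unfolding X_def N0_def cA3_def' by (rule symmetric_four_block_mat[OF cA cA_sym[OF that]])
  have cA3m: "cA3 m = 0\<^sub>m r r" unfolding sub cAm by (intro eq_matI) auto
  have SD_split: "sim_diag_congr n {1..m} M \<longleftrightarrow> (\<exists>P \<in> carrier_mat (p + r) (p + r). invertible_mat P \<and>
      diagonal_mat (mat_congr P (partial_identity p r)) \<and> (\<forall>i\<in>I. diagonal_mat (mat_congr P (M i))))"
    if "M m = partial_identity p r" for M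
    unfolding sim_diag_congr_def insm n using that by auto
  \<comment> \<open>\<open>V\<close>, \<open>q\<close> and \<open>mu\<close> carry information only once this is known, so they cannot be used here.\<close>
  have SD_cA3: "sim_diag_congr (n - p) {1..m} cA3" if SD: "sim_diag_congr n {1..m} cA"
  proof -
    obtain P where P: "P \<in> carrier_mat (p + r) (p + r)" "invertible_mat P"
        "diagonal_mat (mat_congr P (partial_identity p r))" "\<forall>i\<in>I. diagonal_mat (mat_congr P (cA i))"
      using SD unfolding SD_split[of cA, OF cAm] by blast
    have P_blk: "diagonal_mat (mat_congr P (four_block_mat (X i) (N0 i) (N0 i)\<^sup>T (cA3 i)))" if "i \<in> I" for i
      unfolding blk[OF subsetD[OF II that], symmetric] using P(4) that by blast
    obtain V0 where V0: "V0 \<in> carrier_mat r r" "invertible_mat V0"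
        "\<forall>i\<in>I. diagonal_mat (mat_congr V0 (cA3 i))"
      by (rule simultaneous_block_diagonalization_necessary[of I X p N0 r cA3 P,
            OF X N0 cA3 cA3sym[OF subsetD[OF II]] P(1-3) P_blk]) blast+
    have "mat_congr V0 (cA3 m) = 0\<^sub>m r r" unfolding cA3m using V0(1) by (simp add: mat_congr_def)
    then have "diagonal_mat (mat_congr V0 (cA3 m))" by (simp add: diagonal_mat_def)
    then show ?thesis using V0 unfolding sim_diag_congr_def insm r_def[symmetric] by auto
  qed
  have bc: "sim_diag_congr n {1..m} cA \<longleftrightarrow>
      (\<forall>i\<in>I. bA4 i = 0\<^sub>m p (n - p - q)) \<and> (\<forall>i\<in>I. bA2 i = D2 * D3inv * bA3 i) \<and>
      (\<forall>i\<in>I. \<forall>j\<in>I. R i * R j = R j * R i)"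
    if SD3: "sim_diag_congr (n - p) {1..m} cA3"
  proof -
    have wit: "ordered_sd_witness r {1..m} cA3 q V" and weights: "search_weights m q bA3 mu"
      using assms(24)[OF SD3] by (auto simp: r_def)
    have V: "V \<in> carrier_mat r r" "invertible_mat V" and q: "q \<le> r"
      and Vdiag: "\<And>i. i \<in> {1..m} \<Longrightarrow> diagonal_mat (mat_congr V (cA3 i))"
      and pattern: "\<And>j. j < r \<Longrightarrow> (\<exists>i\<in>{1..m}. mat_congr V (cA3 i) $$ (j, j) \<noteq> 0) \<longleftrightarrow> j < q"
      using wit unfolding ordered_sd_witness_def by auto
    have Q2: "Q2 = four_block_mat (1\<^sub>m p) (0\<^sub>m p r) (0\<^sub>m r p) V"
      unfolding Q2_def diag_block_mat_pair using V by simp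
    have Q2c: "Q2 \<in> carrier_mat n n" unfolding Q2 n using V by simp
    have "det Q2 = det V"
      unfolding Q2 using V by (subst det_four_block_mat_upper_right_zero[of _ p _ r]) auto
    then have Q2inv: "invertible_mat Q2"
      using V Q2c invertible_mat_iff_det by metis
    define N where "N i = N0 i * V" for i
    define K where "K i = mat_congr V (cA3 i)" for i
    have N: "N i \<in> carrier_mat p r" and K: "K i \<in> carrier_mat r r" for i
      using N0[of i] V by (auto simp: N_def K_def)
    have Km: "K m = 0\<^sub>m r r" unfolding K_def cA3m using V(1) by (simp add: mat_congr_def)
    have congr_Q2: "mat_congr Q2 (four_block_mat Y Z Z\<^sup>T T) = four_block_mat Y (Z * V) (Z * V)\<^sup>T (mat_congr V T)"
      if Y: "Y \<in> carrier_mat p p" and Z: "Z \<in> carrier_mat p r" and T: "T \<in> carrier_mat r r" for Y Z T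
    proof -
      have "mat_congr Q2 (four_block_mat Y Z Z\<^sup>T T) = four_block_mat (mat_congr (1\<^sub>m p) Y)
          ((1\<^sub>m p)\<^sup>T * Z * V) (V\<^sup>T * Z\<^sup>T * 1\<^sub>m p) (mat_congr V T)"
        unfolding Q2 using V Y Z T by (intro mat_congr_block_diag) auto
      moreover have "mat_congr (1\<^sub>m p) Y = Y" using Y by (simp add: mat_congr_def)
      moreover have "(1\<^sub>m p)\<^sup>T * Z * V = Z * V" using Z V by simp
      moreover have "V\<^sup>T * Z\<^sup>T * 1\<^sub>m p = (Z * V)\<^sup>T"
        using Z V by (simp add: transpose_mult[of _ p r _ r])
      ultimately show ?thesis by simp
    qed
    have bA: "bA i = four_block_mat (X i) (N i) (N i)\<^sup>T (K i)" if "i \<in> {1..m}" for i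
      unfolding bA_def blk[OF that] N_def K_def by (rule congr_Q2[OF X N0 cA3])
    have "bA m = partial_identity p r"
    proof -
      have "X m = 1\<^sub>m p" "N0 m = 0\<^sub>m p r" unfolding sub cAm by (auto intro!: eq_matI)
      then have "X m = 1\<^sub>m p" "N m = 0\<^sub>m p r" using V by (simp_all add: N_def)
      then show ?thesis unfolding bA[OF mI] Km by simp
    qed
    then have SD_bA: "sim_diag_congr n {1..m} bA \<longleftrightarrow> (\<exists>P \<in> carrier_mat (p + r) (p + r). invertible_mat P \<and>
        diagonal_mat (mat_congr P (partial_identity p r)) \<and>
        (\<forall>i\<in>I. diagonal_mat (mat_congr P (four_block_mat (X i) (N i) (N i)\<^sup>T (K i)))))"
      using SD_split[of bA] bA II by (simp add: subset_iff)
    have bA_cA: "sim_diag_congr n {1..m} bA \<longleftrightarrow> sim_diag_congr n {1..m} cA"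
      unfolding bA_def using cA by (intro sim_diag_congr_mat_congr_iff[OF Q2c Q2inv]) (simp add: n)
    have bAc: "bA i \<in> carrier_mat (p + r) (p + r)" for i
      unfolding bA_def n[symmetric] by (rule mat_congr_carrier[OF Q2c])
    have blocks: "bA1 i = X i" "bA2 i = mat p q (\<lambda>(a, b). N i $$ (a, b))"
        "bA3 i = mat q q (\<lambda>(a, b). K i $$ (a, b))" "bA4 i = mat p (r - q) (\<lambda>(a, b). N i $$ (a, q + b))"
      if "i \<in> I" for i
    proof -
      have i: "i \<in> {1..m}" using that II by auto
      note iv = submatrix_interval[OF bAc[of i]]
      show "bA1 i = X i" unfolding bA1_def iv[OF le_add1 le_add1] unfolding bA[OF i]
        using X[of i] K[of i] by (intro eq_matI) auto
      show "bA2 i = mat p q (\<lambda>(a, b). N i $$ (a, b))"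
        unfolding bA2_def iv[OF le_add1 add_left_mono[OF q]] unfolding bA[OF i]
        using X[of i] K[of i] q by (intro eq_matI) auto
      show "bA3 i = mat q q (\<lambda>(a, b). K i $$ (a, b))"
        unfolding bA3_def iv[OF add_left_mono[OF q] add_left_mono[OF q]] unfolding bA[OF i]
        using X[of i] K[of i] q by (intro eq_matI) auto
      show "bA4 i = mat p (r - q) (\<lambda>(a, b). N i $$ (a, q + b))"
        unfolding bA4_def n iv[OF le_add1 order_refl] unfolding bA[OF i]
        using X[of i] K[of i] q by (intro eq_matI) (auto simp: add.assoc)
    qed
    have zero: "K i $$ (b, b) = 0" if "i \<in> I" "q \<le> b" "b < r" for i b
      using pattern[OF that(3)] that II by (auto simp: K_def)
    \<comment> \<open>The index \<open>m\<close> cannot witness a nonzero position since its lower right block is zero.\<close>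
    have nonzero: "\<exists>i\<in>I. bA3 i $$ (b, b) \<noteq> 0" if b: "b < q" for b
    proof -
      have "b < r" using b q by simp
      then obtain i where i: "i \<in> {1..m}" "K i $$ (b, b) \<noteq> 0" using pattern[of b] b by (auto simp: K_def)
      then have "i \<noteq> m" using Km \<open>b < r\<close> by auto
      then have "i \<in> I" using i by (auto simp: I_def)
      then show ?thesis using i b blocks(3) by auto
    qed
    have diagK: "diagonal_mat (K i)" if "i \<in> I" for i using Vdiag that II by (auto simp: K_def)
    have bA3diag: "diagonal_mat (bA3 i)" if "i \<in> I" for i
      using diagK[OF that] K[of i] q unfolding blocks(3)[OF that] by (auto simp: diagonal_mat_def)
    have bA3c: "bA3 i \<in> carrier_mat q q" if "i \<in> I" for i unfolding blocks(3)[OF that] by simp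
    obtain E where "E \<in> carrier_mat q q" "mat_inverse D3 = Some E" "D3 * E = 1\<^sub>m q"
      using search_weights_nonsingular[OF weights \<open>m \<ge> 2\<close>, folded I_def, OF bA3c bA3diag nonzero]
      unfolding D3_def I_def by blast
    then have D3inv: "D3inv \<in> carrier_mat q q" "D3 * D3inv = 1\<^sub>m q" by (simp_all add: D3inv_def)
    have D2': "D2 = mat_lincomb p q I mu (\<lambda>i. mat p q (\<lambda>(a, b). N i $$ (a, b)))"
      unfolding D2_def I_def[symmetric] by (rule mat_lincomb_cong) (rule blocks(2))
    have D3': "D3 = mat_lincomb q q I mu (\<lambda>i. mat q q (\<lambda>(a, b). K i $$ (a, b)))"
      unfolding D3_def I_def[symmetric] by (rule mat_lincomb_cong) (rule blocks(3))
    let ?R = "\<lambda>i. X i - mat p q (\<lambda>(a, b). N i $$ (a, b)) * D3inv * D2\<^sup>T"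
    have R': "R i = ?R i" if "i \<in> I" for i
      unfolding R_def blocks(1,2)[OF that] ..
    have "finite I" by (simp add: I_def)
    have symX: "(X i)\<^sup>T = X i" if "i \<in> I" for i using Xsym that II by blast
    have c4: "bA4 i = 0\<^sub>m p (n - p - q) \<longleftrightarrow> (\<forall>a<p. \<forall>b. q \<le> b \<and> b < r \<longrightarrow> N i $$ (a, b) = 0)"
      if i: "i \<in> I" for i
    proof
      assume z: "bA4 i = 0\<^sub>m p (n - p - q)"
      show "\<forall>a<p. \<forall>b. q \<le> b \<and> b < r \<longrightarrow> N i $$ (a, b) = 0"
      proof (intro allI impI)
        fix a b assume ab: "a < p" "q \<le> b \<and> b < r"
        then have b: "b - q < r - q" "q + (b - q) = b" using q by auto
        then have "bA4 i $$ (a, b - q) = N i $$ (a, b)" using ab by (simp add: blocks(4)[OF i])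
        then show "N i $$ (a, b) = 0" using ab b by (simp add: z n)
      qed
    next
      assume "\<forall>a<p. \<forall>b. q \<le> b \<and> b < r \<longrightarrow> N i $$ (a, b) = 0"
      then show "bA4 i = 0\<^sub>m p (n - p - q)"
        unfolding blocks(4)[OF i] by (intro eq_matI) (auto simp: n)
    qed
    have "sim_diag_congr n {1..m} cA \<longleftrightarrow> sim_diag_congr n {1..m} bA" by (rule bA_cA[symmetric])
    also have "\<dots> \<longleftrightarrow> (\<forall>i\<in>I. \<forall>a<p. \<forall>b. q \<le> b \<and> b < r \<longrightarrow> N i $$ (a, b) = 0) \<and>
        (\<forall>i\<in>I. mat p q (\<lambda>(a, b). N i $$ (a, b)) = D2 * D3inv * mat q q (\<lambda>(a, b). K i $$ (a, b))) \<and>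
        (\<forall>i\<in>I. \<forall>j\<in>I. ?R i * ?R j = ?R j * ?R i)"
      unfolding SD_bA D2'
      by (rule simultaneous_block_diagonalization_iff[of I X p N r K q D3inv mu,
            OF \<open>finite I\<close> X symX N K diagK q zero D3inv(1) D3inv(2)[unfolded D3']])
    also have "\<dots> \<longleftrightarrow> (\<forall>i\<in>I. bA4 i = 0\<^sub>m p (n - p - q)) \<and> (\<forall>i\<in>I. bA2 i = D2 * D3inv * bA3 i) \<and>
        (\<forall>i\<in>I. \<forall>j\<in>I. R i * R j = R j * R i)"
      by (intro arg_cong2[of _ _ _ _ "(\<and>)"] ball_cong refl) (simp_all only: c4 blocks(2,3) R')
    finally show ?thesis .
  qed
  show ?thesis using ab SD_cA SD_cA3 bc unfolding I_def by blast
qed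

end
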